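(* Let $\mathcal{D}$ be a distribution on $\mathbb{R}$ such that for $T\sim\mathcal{D}$, $\mathbb{E}[T]=0$, $\mathbb{E}[T^2]=1$ and $\mathbb{E}[|T|^3]<\infty$. Fix $\kappa>0$, $\alpha<\alpha_c(\kappa)$, $m\in\mathbb{N}$, $0<\eta<\beta<1$. Then \[ \mathbb{E}_{\mathcal{M}_{ij}\sim\mathcal{D}\ \text{i.i.d.}}\bigl[|\mathcal{S}_\kappa(\beta,\eta,m,\alpha)|\bigr]\le\mathbb{E}_{\mathcal{M}_{ij}\sim\mathcal{N}(0,1)\ \text{i.i.d.}}\bigl[|\mathcal{S}_\kappa(\beta,\eta,m,\alpha)|\bigr]\,e^{O(\sqrt n)}, \] where the $O(\sqrt n)$ term is bounded by $C'\sqrt n$ for a constant $C'$ independent of $n$.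
   Context: $\mathcal{B}_n=\{-1,1\}^n$, $\alpha_c(\kappa)=-1/\log_2\mathbb{P}[|Z|\le\kappa]$ for $Z\sim\mathcal{N}(0,1)$, $M=\lfloor n\alpha\rfloor$, and $\mathcal{M}\in\mathbb{R}^{M\times n}$ is a random matrix with i.i.d. entries of the indicated distribution. $\mathcal{S}_\kappa(\beta,\eta,m,\alpha)$ denotes the set of $m$-tuples $(\sigma^{(1)},\dots,\sigma^{(m)})\in\mathcal{B}_n^m$ with $\beta-\eta\le n^{-1}\langle\sigma^{(i)},\sigma^{(j)}\rangle\le\beta$ for all $i<j$ and $\|\mathcal{M}\sigma^{(i)}\|_\infty\le\kappa\sqrt n$ for all $i$ (all constraints with respect to the same matrix $\mathcal{M}$). *)

theory Defs
  imports "HOL-Probability.Probability"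
begin

text \<open>
  Vectors of length \<open>n\<close> are functions on \<open>{..<n}\<close>, an \<open>M \<times> n\<close> matrix is a function on
  \<open>{..<M} \<times> {..<n}\<close>. Sign vectors and tuples of sign vectors live in extensional function
  spaces, so that their cardinalities are the intended ones.
\<close>

definition sign_cube :: "nat \<Rightarrow> (nat \<Rightarrow> real) set" where
  "sign_cube n = {..<n} \<rightarrow>\<^sub>E {-1, 1}"

definition inner_n :: "nat \<Rightarrow> (nat \<Rightarrow> real) \<Rightarrow> (nat \<Rightarrow> real) \<Rightarrow> real" where
  "inner_n n x y = (\<Sum>k<n. x k * y k)"

definition mat_vec :: "nat \<Rightarrow> (nat \<times> nat \<Rightarrow> real) \<Rightarrow> (nat \<Rightarrow> real) \<Rightarrow> nat \<Rightarrow> real" where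
  "mat_vec n A x = (\<lambda>i. \<Sum>k<n. A (i, k) * x k)"

text \<open>The inserted \<open>0\<close> only matters for \<open>M = 0\<close>, where the norm on the zero space is \<open>0\<close>.\<close>

definition sup_norm :: "nat \<Rightarrow> (nat \<Rightarrow> real) \<Rightarrow> real" where
  "sup_norm M y = Max (insert 0 ((\<lambda>i. \<bar>y i\<bar>) ` {..<M}))"

definition alpha_c :: "real \<Rightarrow> real" where
  "alpha_c \<kappa> = - 1 / log 2 (measure std_normal_distribution {z. \<bar>z\<bar> \<le> \<kappa>})"

definition num_rows :: "real \<Rightarrow> nat \<Rightarrow> nat" where
  "num_rows \<alpha> n = nat \<lfloor>real n * \<alpha>\<rfloor>"

definition sol_tuples ::
  "real \<Rightarrow> real \<Rightarrow> real \<Rightarrow> nat \<Rightarrow> real \<Rightarrow> nat \<Rightarrow> (nat \<times> nat \<Rightarrow> real) \<Rightarrow> (nat \<Rightarrow> nat \<Rightarrow> real) set" where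
  "sol_tuples \<kappa> \<beta> \<eta> m \<alpha> n A =
     {\<sigma> \<in> {..<m} \<rightarrow>\<^sub>E sign_cube n.
        (\<forall>i<m. \<forall>j<m. i < j \<longrightarrow>
           \<beta> - \<eta> \<le> inner_n n (\<sigma> i) (\<sigma> j) / real n \<and> inner_n n (\<sigma> i) (\<sigma> j) / real n \<le> \<beta>) \<and>
        (\<forall>i<m. sup_norm (num_rows \<alpha> n) (mat_vec n A (\<sigma> i)) \<le> \<kappa> * sqrt (real n))}"

text \<open>The law of an \<open>M \<times> n\<close> matrix with i.i.d. entries distributed according to \<open>D\<close>.\<close>

definition iid_matrix :: "real measure \<Rightarrow> nat \<Rightarrow> nat \<Rightarrow> (nat \<times> nat \<Rightarrow> real) measure" where
  "iid_matrix D M n = (\<Pi>\<^sub>M ij\<in>{..<M} \<times> {..<n}. D)"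

definition expected_sol_tuples ::
  "real measure \<Rightarrow> real \<Rightarrow> real \<Rightarrow> real \<Rightarrow> nat \<Rightarrow> real \<Rightarrow> nat \<Rightarrow> real" where
  "expected_sol_tuples D \<kappa> \<beta> \<eta> m \<alpha> n =
     (\<integral>A. real (card (sol_tuples \<kappa> \<beta> \<eta> m \<alpha> n A)) \<partial>iid_matrix D (num_rows \<alpha> n) n)"

end

theory Submission
  imports Defs "HOL-Real_Asymp.Real_Asymp"
begin

text \<open>
  The expected number of tuples is a sum, over the tuples \<open>\<sigma>\<close> with the right overlaps, of
  \<open>p(\<sigma>) ^ M\<close>, where \<open>p(\<sigma>)\<close> is the probability that a single random row satisfies all \<open>m\<close>
  constraints. Hence it is enough to show \<open>p\<^sub>D \<le> p\<^sub>N + C / sqrt n\<close> and \<open>p\<^sub>N \<ge> c > 0\<close>, uniformly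
  in \<open>\<sigma>\<close>. The \<open>m\<close> inner products may be (nearly) linearly dependent, so a multivariate
  Berry-Esseen theorem does not apply. Instead the entries are replaced by Gaussian ones block by
  block, a block \<open>B\<close> being a set of coordinates with a common sign pattern. Within a block only the
  scalar sum of the entries matters, and given that this sum equals \<open>s\<close>, the probability of the
  constraints is a function \<open>H(s)\<close> of the remaining coordinates. Their sums have concentration
  function \<open>O(1 / sqrt n)\<close>, which makes \<open>H\<close> Lipschitz with constant \<open>O(1 / sqrt n)\<close> on scales
  above \<open>1\<close>; and by Stein's method the unnormalised block sum is at Wasserstein distance \<open>O(1)\<close>
  from its Gaussian counterpart, no matter how small the block is.
\<close>

section \<open>Solutions of the Stein equation\<close>


text \<open>There are at most \<open>\<bar>\<alpha>\<bar> * n\<close> rows, so a factor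
  \<open>1 + O(1 / sqrt n)\<close> per row is exactly what \<open>exp (O(sqrt n))\<close> permits;
  the lower bound \<open>c\<close> turns the additive row error into such a factor. A block may
  consist of a single coordinate, so its sum need not look Gaussian, and O(1) is all one can expect
  of the Wasserstein distance. This is harmless because the function averaged over the block sum
  varies on the scale sqrt n set by the other coordinates. The law \<open>D\<close> may have atoms,
  so \<open>H\<close> can jump by order 1 / sqrt n and need not be Lipschitz. It is majorised by a
  Lipschitz function that exceeds it by no more than that order; a majorant is enough since the
  claim is one-sided. The number of blocks depends on \<open>m\<close> alone, so adding up the
  replacement errors preserves the order. The lower bound cannot come from a joint density of the
  \<open>m\<close> Gaussian constraints, whose covariance may be singular. It comes from making
  every one of the boundedly many independent block sums small.\<close>

text \<open>Both \<open>B + Q\<close> and \<open>B - Q\<close> are nonincreasing on the half-line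
  and tend to 0, hence are nonnegative at \<open>w\<close>. Tail estimates thus reduce to guessing
  \<open>B\<close> and comparing derivatives pointwise, without handling improper integrals.\<close>

lemma abs_le_of_derivative_bound:
  fixes Q q B b :: "real \<Rightarrow> real"
  assumes Q: "\<And>x. x \<ge> w \<Longrightarrow> (Q has_real_derivative q x) (at x)"
    and B: "\<And>x. x \<ge> w \<Longrightarrow> (B has_real_derivative - b x) (at x)"
    and le: "\<And>x. x \<ge> w \<Longrightarrow> \<bar>q x\<bar> \<le> b x"
    and Q0: "(Q \<longlongrightarrow> 0) at_top" and B0: "(B \<longlongrightarrow> 0) at_top"
  shows "\<bar>Q w\<bar> \<le> B w"
proof -
  have "B x + s * Q x \<le> B w + s * Q w" if "x \<ge> w" "\<bar>s\<bar> = 1" for x s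
  proof (rule DERIV_nonpos_imp_nonincreasing[OF that(1)])
    fix y assume "w \<le> y" "y \<le> x"
    then have "((\<lambda>x. B x + s * Q x) has_real_derivative (- b y + s * q y)) (at y)"
      by (auto intro!: derivative_eq_intros Q B)
    moreover have "s * q y \<le> \<bar>q y\<bar>"
      using that(2) by (metis abs_ge_self abs_mult mult_1)
    then have "- b y + s * q y \<le> 0"
      using le[OF \<open>w \<le> y\<close>] by linarith
    ultimately show "\<exists>z. ((\<lambda>x. B x + s * Q x) has_real_derivative z) (at y) \<and> z \<le> 0"
      by blast
  qed
  then have "0 \<le> B w + s * Q w" if "\<bar>s\<bar> = 1" for s
    using that
    by (intro tendsto_upperbound[where f="\<lambda>x. B x + s * Q x" and F=at_top])
       (auto intro!: tendsto_eq_intros Q0 B0 eventually_at_top_linorderI[of w])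
  from this[of 1] this[of "-1"] show ?thesis by (auto simp: abs_le_iff)
qed

text \<open>Integrability gives any antiderivative a limit at each end, and the zero total integral
  makes the two limits equal, so a single additive constant removes both. Decay at both ends is what
  later bounds the Stein solution on both tails.\<close>

lemma antiderivative_vanishing_at_infinity:
  fixes q :: "real \<Rightarrow> real"
  assumes cont: "continuous_on UNIV q" and int: "integrable lborel q"
    and zero: "(\<integral>x. q x \<partial>lborel) = 0"
  obtains Q where "\<And>x. (Q has_real_derivative q x) (at x)"
    and "(Q \<longlongrightarrow> 0) at_top" and "(Q \<longlongrightarrow> 0) at_bot"
proof -
  have "\<exists>F. \<forall>x. - \<infinity> < ereal x \<longrightarrow> ereal x < \<infinity> \<longrightarrow> (F has_vector_derivative q x) (at x)"
    using cont by (intro einterval_antiderivative) (auto simp: continuous_on_eq_continuous_at)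
  then obtain F where F: "\<And>x. (F has_real_derivative q x) (at x)"
    by (auto simp: has_real_derivative_iff_has_vector_derivative)
  have FTC: "(LBINT x:{a..b}. q x) = F b - F a" if "a \<le> b" for a b
    unfolding set_lebesgue_integral_def
    using integral_FTC_atLeastAtMost[OF that, of F q] F cont
    by (auto simp: has_real_derivative_iff_has_vector_derivative
        intro: has_vector_derivative_at_within continuous_on_subset)
  define I1 where "I1 = (LBINT x:{0..}. q x)"
  define I2 where "I2 = (LBINT x:{..0}. q x)"
  have si: "set_integrable lborel A q" if "A \<in> sets lborel" for A
    unfolding set_integrable_def using int that by (rule integrable_mult_indicator[rotated])
  have "I2 + (LBINT x:{0<..}. q x) = (LBINT x:{..0} \<union> {0<..}. q x)"
    unfolding I2_def by (rule set_integral_Un[symmetric]) (auto intro!: si)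
  moreover have "{..0::real} \<union> {0<..} = UNIV" by auto
  moreover have "(LBINT x:{0<..}. q x) = I1"
    unfolding I1_def set_lebesgue_integral_def
    by (rule integral_cong_AE)
       (use int AE_lborel_singleton[of 0] in \<open>auto simp: indicator_def elim!: eventually_mono\<close>)
  ultimately have I: "I2 + I1 = 0"
    using zero by (simp add: set_lebesgue_integral_def)
  have "((\<lambda>b. LBINT x:{0..b}. q x) \<longlongrightarrow> I1) at_top"
    unfolding I1_def by (rule tendsto_set_lebesgue_integral_at_top) (auto intro!: si)
  moreover have "eventually (\<lambda>b. (LBINT x:{0..b}. q x) = F b - F 0) at_top"
    using eventually_ge_at_top[of "0::real"] by eventually_elim (rule FTC)
  ultimately have "((\<lambda>b. F b - F 0) \<longlongrightarrow> I1) at_top"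
    using tendsto_cong by fastforce
  from tendsto_diff[OF this tendsto_const[of I1]]
  have top: "((\<lambda>b. F b - (F 0 + I1)) \<longlongrightarrow> 0) at_top"
    by (simp add: algebra_simps)
  have "((\<lambda>a. LBINT x:{a..0}. q x) \<longlongrightarrow> I2) at_bot"
    unfolding I2_def by (rule tendsto_set_lebesgue_integral_at_bot) (auto intro!: si)
  moreover have "eventually (\<lambda>a. (LBINT x:{a..0}. q x) = F 0 - F a) at_bot"
    using eventually_le_at_bot[of "0::real"] by eventually_elim (rule FTC)
  ultimately have "((\<lambda>a. F 0 - F a) \<longlongrightarrow> I2) at_bot"
    using tendsto_cong by fastforce
  from tendsto_diff[OF tendsto_const[of I2] this]
  have bot: "((\<lambda>a. F a - (F 0 + I1)) \<longlongrightarrow> 0) at_bot"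
  proof -
    have "I2 - (F 0 - F a) = F a - (F 0 + I1)" for a
      using I by (simp add: algebra_simps)
    then show ?thesis
      using \<open>((\<lambda>a. I2 - (F 0 - F a)) \<longlongrightarrow> I2 - I2) at_bot\<close> by (simp only: diff_self)
  qed
  show thesis
    by (rule that[of "\<lambda>x. F x - (F 0 + I1)"]) (auto intro!: derivative_eq_intros F top bot)
qed

lemma exp_sq_tendsto_0: "((\<lambda>x::real. exp (- x\<^sup>2 / 2)) \<longlongrightarrow> 0) at_top"
  by real_asymp

text \<open>Here \<open>Q\<close> is the Stein solution \<open>f\<close> times the Gaussian weight,
  so the second expression is \<open>f' w\<close> times that weight. The decay \<open>3 / w\<close>
  of \<open>f'\<close> is needed, beyond mere boundedness, to control \<open>w * f' w\<close>. The
  first bound compares \<open>\<bar>h x - \<mu>\<bar> \<le> 2 * x\<close> with the derivative of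
  \<open>2 * exp (- x\<^sup>2 / 2)\<close>.\<close>

lemma stein_tail:
  fixes h Q :: "real \<Rightarrow> real"
  assumes h: "\<And>x y. \<bar>h x - h y\<bar> \<le> \<bar>x - y\<bar>" and mu: "\<bar>h 0 - \<mu>\<bar> \<le> 1"
    and Q: "\<And>x. (Q has_real_derivative (h x - \<mu>) * exp (- x\<^sup>2 / 2)) (at x)"
    and Q0: "(Q \<longlongrightarrow> 0) at_top" and w: "w \<ge> 1"
  shows "\<bar>Q w\<bar> \<le> 2 * exp (- w\<^sup>2 / 2)"
    and "\<bar>w * Q w + (h w - \<mu>) * exp (- w\<^sup>2 / 2)\<bar> \<le> 3 / w * exp (- w\<^sup>2 / 2)"
proof -
  have hx: "\<bar>h x - \<mu>\<bar> \<le> \<bar>x\<bar> + 1" for x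
    using h[of x 0] mu by auto
  show "\<bar>Q w\<bar> \<le> 2 * exp (- w\<^sup>2 / 2)"
  proof (rule abs_le_of_derivative_bound[where Q=Q and q="\<lambda>x. (h x - \<mu>) * exp (- x\<^sup>2 / 2)"
      and B="\<lambda>w. 2 * exp (- w\<^sup>2 / 2)" and b="\<lambda>x. 2 * x * exp (- x\<^sup>2 / 2)"])
    fix x assume "x \<ge> w"
    then have "\<bar>h x - \<mu>\<bar> \<le> 2 * x" using hx[of x] w by linarith
    then show "\<bar>(h x - \<mu>) * exp (- x\<^sup>2 / 2)\<bar> \<le> 2 * x * exp (- x\<^sup>2 / 2)"
      by (simp add: abs_mult mult_right_mono)
    show "((\<lambda>w. 2 * exp (- w\<^sup>2 / 2)) has_real_derivative - (2 * x * exp (- x\<^sup>2 / 2))) (at x)"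
      by (auto intro!: derivative_eq_intros)
  qed (rule Q Q0 tendsto_mult_right_zero[OF exp_sq_tendsto_0])+
  \<comment> \<open>Freezing \<open>w\<close> and \<open>h w\<close> while \<open>x\<close> varies
    avoids differentiating \<open>h\<close>, which is only Lipschitz. The comparison function equals
    \<open>3 / w\<close> times the weight at \<open>x = w\<close>; its slope 3 in
    \<open>x - w\<close> absorbs the bound \<open>3 * w * (x - w)\<close> on the derivative of
    \<open>?\<Psi>\<close>.\<close>
  let ?\<Psi> = "\<lambda>x. w * Q x + (h w - \<mu>) * exp (- x\<^sup>2 / 2)"
  let ?B = "\<lambda>x. (3 / w + 3 * (x - w)) * exp (- x\<^sup>2 / 2)"
  have "\<bar>?\<Psi> w\<bar> \<le> ?B w"
  proof (rule abs_le_of_derivative_bound[where Q="?\<Psi>" and B="?B"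
      and q="\<lambda>x. (w * (h x - \<mu>) - x * (h w - \<mu>)) * exp (- x\<^sup>2 / 2)"
      and b="\<lambda>x. ((3 / w + 3 * (x - w)) * x - 3) * exp (- x\<^sup>2 / 2)"])
    fix x assume x: "x \<ge> w"
    show "(?\<Psi> has_real_derivative (w * (h x - \<mu>) - x * (h w - \<mu>)) * exp (- x\<^sup>2 / 2)) (at x)"
      by (auto intro!: derivative_eq_intros Q[THEN DERIV_cong] simp: algebra_simps)
    show "(?B has_real_derivative - (((3 / w + 3 * (x - w)) * x - 3) * exp (- x\<^sup>2 / 2))) (at x)"
      using w by (auto intro!: derivative_eq_intros simp: algebra_simps)
    have "w * (h x - \<mu>) - x * (h w - \<mu>) = w * (h x - h w) - (x - w) * (h w - \<mu>)"
      by (simp add: algebra_simps)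
    also have "\<bar>\<dots>\<bar> \<le> w * \<bar>h x - h w\<bar> + (x - w) * \<bar>h w - \<mu>\<bar>"
      using w x by (intro order_trans[OF abs_triangle_ineq4]) (simp add: abs_mult)
    also have "\<dots> \<le> w * (x - w) + (x - w) * (2 * w)"
      using w x h[of x w] hx[of w] by (intro add_mono mult_left_mono) auto
    also have "\<dots> = 3 * w * (x - w)" by (simp add: algebra_simps)
    also have "\<dots> \<le> 3 * (x - w) * x + (3 * x / w - 3)"
    proof -
      have "3 * (x - w) * w \<le> 3 * (x - w) * x" using w x by (intro mult_left_mono) auto
      moreover have "3 * x / w \<ge> 3" "3 * (x - w) * w = 3 * w * (x - w)" using w x by (simp_all add: field_simps)
      ultimately show ?thesis by linarith
    qed
    also have "\<dots> = (3 / w + 3 * (x - w)) * x - 3"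
      by (simp add: algebra_simps)
    finally show "\<bar>(w * (h x - \<mu>) - x * (h w - \<mu>)) * exp (- x\<^sup>2 / 2)\<bar>
        \<le> ((3 / w + 3 * (x - w)) * x - 3) * exp (- x\<^sup>2 / 2)"
      by (simp add: abs_mult mult_right_mono)
  next
    show "(?\<Psi> \<longlongrightarrow> 0) at_top"
      using tendsto_add[OF tendsto_mult_right_zero[OF Q0] tendsto_mult_right_zero[OF exp_sq_tendsto_0]]
      by simp
    show "(?B \<longlongrightarrow> 0) at_top"
      by real_asymp
  qed
  then show "\<bar>w * Q w + (h w - \<mu>) * exp (- w\<^sup>2 / 2)\<bar> \<le> 3 / w * exp (- w\<^sup>2 / 2)"
    by simp
qed

text \<open>The solution is \<open>exp (x\<^sup>2 / 2)\<close> times the antiderivative of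
  \<open>(h - \<mu>) * exp (- x\<^sup>2 / 2)\<close> that vanishes at both ends. Since
  \<open>h\<close> is merely Lipschitz, a second derivative may not exist everywhere, and a
  Lipschitz bound on \<open>f'\<close> takes its place. The constants are crude.\<close>

lemma stein_solution:
  fixes h :: "real \<Rightarrow> real"
  assumes h: "\<And>x y. \<bar>h x - h y\<bar> \<le> \<bar>x - y\<bar>"
  obtains f f' \<mu> where "\<And>x. (f has_real_derivative f' x) (at x)"
    and "\<And>x. f' x = x * f x + h x - \<mu>"
    and "\<And>x. \<bar>f x\<bar> \<le> 10" and "\<And>x. \<bar>f' x\<bar> \<le> 12"
    and "\<And>x y. \<bar>f' x - f' y\<bar> \<le> 23 * \<bar>x - y\<bar>"
proof -
  have cont_h: "continuous_on UNIV h"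
    by (rule lipschitz_on_continuous_on[OF lipschitz_onI[of UNIV h 1]]) (use h in \<open>auto simp: dist_real_def\<close>)
  have hm[measurable]: "h \<in> borel_measurable borel"
    using cont_h by (rule borel_measurable_continuous_onI)
  have h0: "\<bar>h x\<bar> \<le> \<bar>h 0\<bar> + \<bar>x\<bar>" for x
    using h[of x 0] by auto
  have int_h: "integrable lborel (\<lambda>x. std_normal_density x * h x)"
  proof (rule Bochner_Integration.integrable_bound)
    show "integrable lborel (\<lambda>x. std_normal_density x * \<bar>h 0\<bar> + std_normal_density x * \<bar>x\<bar> ^ 1)"
      using integrable_std_normal_moment_abs[of 1] integrable_std_normal_moment[of 0]
      by (intro Bochner_Integration.integrable_add integrable_mult_left) simp_all
    show "AE x in lborel. norm (std_normal_density x * h x)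
        \<le> norm (std_normal_density x * \<bar>h 0\<bar> + std_normal_density x * \<bar>x\<bar> ^ 1)"
      by (auto simp: abs_mult abs_of_nonneg distrib_left[symmetric] intro!: mult_left_mono h0)
  qed simp
  define \<mu> where "\<mu> = (\<integral>x. std_normal_density x * h x \<partial>lborel)"
  have one: "(\<integral>x. std_normal_density x \<partial>lborel) = 1" "integrable lborel std_normal_density"
    using integral_std_normal_moment_even[of 0] integrable_std_normal_moment[of 0] by simp_all
  \<comment> \<open>The normal mean of \<open>h\<close> differs from \<open>h 0\<close> by at most
    the mean of \<open>\<bar>Z\<bar>\<close>, which is \<open>sqrt (2 / pi)\<close>. This supplies
    the normalisation required by \<open>stein_tail\<close>.\<close>
  have "\<bar>\<mu> - h 0\<bar> = \<bar>\<integral>x. std_normal_density x * (h x - h 0) \<partial>lborel\<bar>"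
    using int_h one by (simp add: \<mu>_def right_diff_distrib)
  also have "\<dots> \<le> (\<integral>x. std_normal_density x * \<bar>x\<bar> ^ 1 \<partial>lborel)"
  proof (rule order_trans[OF integral_abs_bound integral_mono])
    show "integrable lborel (\<lambda>x. \<bar>std_normal_density x * (h x - h 0)\<bar>)"
      using int_h one by (auto simp: right_diff_distrib)
    show "integrable lborel (\<lambda>x. std_normal_density x * \<bar>x\<bar> ^ 1)"
      by (rule integrable_std_normal_moment_abs)
    show "\<bar>std_normal_density x * (h x - h 0)\<bar> \<le> std_normal_density x * \<bar>x\<bar> ^ 1" for x
      using h[of x 0] by (simp add: abs_mult mult_left_mono)
  qed
  also have "\<dots> = sqrt (2 / pi)"
    using integral_std_normal_moment_abs_odd[of 0] by simp
  also have "\<dots> \<le> 1"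
    using pi_gt3 by simp
  finally have mu: "\<bar>h 0 - \<mu>\<bar> \<le> 1" by simp
  define q where "q x = (h x - \<mu>) * exp (- x\<^sup>2 / 2)" for x
  have q_eq: "q x = sqrt (2 * pi) * (std_normal_density x * h x - std_normal_density x * \<mu>)" for x
    by (simp add: q_def std_normal_density_def algebra_simps)
  have "continuous_on UNIV q"
    unfolding q_def by (intro continuous_intros cont_h) auto
  moreover have "integrable lborel q" "(\<integral>x. q x \<partial>lborel) = 0"
    unfolding q_eq using int_h one by (auto simp: \<mu>_def)
  ultimately obtain Q where Q: "\<And>x. (Q has_real_derivative q x) (at x)"
    and Qt: "(Q \<longlongrightarrow> 0) at_top" and Qb: "(Q \<longlongrightarrow> 0) at_bot"
    using antiderivative_vanishing_at_infinity by blast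
  define f where "f x = exp (x\<^sup>2 / 2) * Q x" for x
  define f' where "f' x = x * f x + h x - \<mu>" for x
  have Qf: "Q x = f x * exp (- x\<^sup>2 / 2)" for x
    by (simp add: f_def exp_minus)
  have fd: "(f has_real_derivative f' x) (at x)" for x
    unfolding f_def[abs_def] f'_def
    by (auto intro!: derivative_eq_intros Q[THEN DERIV_cong] simp: q_def exp_minus f_def field_simps)
  have tail: "\<bar>f w\<bar> \<le> 2 \<and> \<bar>f' w\<bar> \<le> 3 / \<bar>w\<bar>" if "\<bar>w\<bar> \<ge> 1" for w
  proof -
    have "\<bar>Q w\<bar> \<le> 2 * exp (- w\<^sup>2 / 2) \<and>
      \<bar>w * Q w + (h w - \<mu>) * exp (- w\<^sup>2 / 2)\<bar> \<le> 3 / \<bar>w\<bar> * exp (- w\<^sup>2 / 2)"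
    proof (cases "w \<ge> 1")
      case True
      then show ?thesis
        using stein_tail[OF h mu Q[unfolded q_def] Qt True] by simp
    next
      case False
      then have w: "- w \<ge> 1" using that by linarith
      \<comment> \<open>Reflection turns the left tail into a right tail for \<open>h (- x)\<close>;
        the outer sign restores the form of the derivative.\<close>
      have "((\<lambda>x. - Q (- x)) has_real_derivative (h (- x) - \<mu>) * exp (- x\<^sup>2 / 2)) (at x)" for x
      proof -
        have "((\<lambda>x. Q (- x)) has_real_derivative q (- x) * - 1) (at x)"
          by (rule DERIV_chain2[where g=uminus]) (auto intro!: Q derivative_eq_intros)
        from DERIV_minus[OF this] show ?thesis by (simp add: q_def)
      qed
      moreover have "((\<lambda>x. - Q (- x)) \<longlongrightarrow> 0) at_top"
        using Qb by (auto simp: filterlim_at_bot_mirror intro!: tendsto_eq_intros)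
      moreover have "\<bar>h (- x) - h (- y)\<bar> \<le> \<bar>x - y\<bar>" for x y
        using h[of "-x" "-y"] by simp
      ultimately show ?thesis
        using stein_tail[of "\<lambda>x. h (- x)" \<mu> "\<lambda>x. - Q (- x)" "- w"] mu w by simp
    qed
    moreover have "w * Q w + (h w - \<mu>) * exp (- w\<^sup>2 / 2) = f' w * exp (- w\<^sup>2 / 2)"
      by (simp add: f'_def Qf algebra_simps)
    ultimately have "\<bar>f w\<bar> * exp (- w\<^sup>2 / 2) \<le> 2 * exp (- w\<^sup>2 / 2)"
      and "\<bar>f' w\<bar> * exp (- w\<^sup>2 / 2) \<le> 3 / \<bar>w\<bar> * exp (- w\<^sup>2 / 2)"
      by (simp_all only: Qf abs_mult abs_exp_cancel)
    then show ?thesis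
      by (metis exp_gt_zero mult_le_cancel_right_pos)
  qed
  \<comment> \<open>On the middle interval \<open>Q\<close> is integrated back from 1, where the
    tail bound holds. Undoing the weight costs \<open>exp (1 / 2) \<le> 2\<close>, giving
    \<open>2 + 4 * exp (1 / 2) \<le> 10\<close>.\<close>
  have mid: "\<bar>f w\<bar> \<le> 10" if "\<bar>w\<bar> \<le> 1" for w
  proof -
    have "\<bar>q x\<bar> \<le> 2" if "\<bar>x\<bar> \<le> 1" for x
    proof -
      have "\<bar>h x - \<mu>\<bar> \<le> 2" using h[of x 0] mu that by linarith
      moreover have "exp (- x\<^sup>2 / 2) \<le> 1" by simp
      ultimately show ?thesis
        unfolding q_def abs_mult using mult_mono[of "\<bar>h x - \<mu>\<bar>" 2 "exp (- x\<^sup>2 / 2)" 1] by simp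
    qed
    then have "norm (Q 1 - Q w) \<le> 2 * norm (1 - w)"
      using that Q by (intro field_differentiable_bound[of "{-1..1}" Q q])
        (auto intro: has_field_derivative_at_within)
    moreover have "\<bar>Q 1\<bar> \<le> 2 * exp (- 1 / 2)"
      using stein_tail(1)[OF h mu Q[unfolded q_def] Qt, of 1] by simp
    ultimately have "\<bar>Q w\<bar> \<le> 2 * exp (- 1 / 2) + 4"
      using that by (simp add: abs_le_iff)
    moreover have "exp (w\<^sup>2 / 2) \<le> exp (1 / 2)"
      using that by (simp add: abs_square_le_1)
    ultimately have "\<bar>f w\<bar> \<le> exp (1 / 2) * (2 * exp (- 1 / 2) + 4)"
      unfolding f_def abs_mult by (intro mult_mono) auto
    also have "\<dots> = 2 + 4 * exp (1 / 2)"
      by (simp add: distrib_left exp_minus)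
    also have "exp (1 / 2 :: real) \<le> 2"
      using exp_bound[of "1/2::real"] by (simp add: power2_eq_square)
    finally show ?thesis by simp
  qed
  have f_le: "\<bar>f x\<bar> \<le> 10" for x
    using tail[of x] mid[of x] by (cases "\<bar>x\<bar> \<le> 1") auto
  have f'_tail: "\<bar>f' x\<bar> \<le> 3 \<and> \<bar>x * f' x\<bar> \<le> 3" if "\<bar>x\<bar> \<ge> 1" for x
  proof -
    have "\<bar>x\<bar> * \<bar>f' x\<bar> \<le> 3"
      using tail[OF that] that by (simp add: field_simps)
    moreover have "1 * \<bar>f' x\<bar> \<le> \<bar>x\<bar> * \<bar>f' x\<bar>"
      using that by (intro mult_right_mono) auto
    ultimately show ?thesis by (simp add: abs_mult)
  qed
  have f'_mid: "\<bar>f' x\<bar> \<le> 12 \<and> \<bar>x * f' x\<bar> \<le> 12" if "\<bar>x\<bar> \<le> 1" for x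
  proof -
    have "\<bar>x * f x\<bar> \<le> 1 * 10"
      unfolding abs_mult using that f_le by (intro mult_mono) auto
    then have *: "\<bar>f' x\<bar> \<le> 12"
      using h[of x 0] mu that unfolding f'_def by linarith
    have "\<bar>x * f' x\<bar> \<le> 1 * 12"
      unfolding abs_mult using that * by (intro mult_mono) auto
    with * show ?thesis by simp
  qed
  have f'_le: "\<bar>f' x\<bar> \<le> 12" "\<bar>x * f' x\<bar> \<le> 12" for x
    using f'_tail[of x] f'_mid[of x] by (cases "\<bar>x\<bar> \<le> 1"; auto)+
  \<comment> \<open>The derivative of \<open>x * f x\<close> is at most \<open>10 + 12\<close>,
    where the decay of \<open>f'\<close> bounds \<open>x * f' x\<close>. Adding the Lipschitz
    constant 1 of \<open>h\<close> in the Stein equation gives 23.\<close>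
  have xf: "norm (x * f x - y * f y) \<le> 22 * norm (x - y)" for x y
  proof (rule field_differentiable_bound[of UNIV _ "\<lambda>z. f z + z * f' z"])
    fix z
    show "((\<lambda>z. z * f z) has_real_derivative f z + z * f' z) (at z within UNIV)"
      by (auto intro!: derivative_eq_intros fd[THEN DERIV_cong])
    show "norm (f z + z * f' z) \<le> 22"
      using f_le[of z] f'_le(2)[of z] by simp
  qed auto
  have "\<bar>f' x - f' y\<bar> \<le> 23 * \<bar>x - y\<bar>" for x y
  proof -
    have "\<bar>f' x - f' y\<bar> = \<bar>(x * f x - y * f y) + (h x - h y)\<bar>"
      by (simp add: f'_def)
    also have "\<dots> \<le> \<bar>x * f x - y * f y\<bar> + \<bar>h x - h y\<bar>"
      by (rule abs_triangle_ineq)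
    finally show ?thesis
      using xf[of x y] h[of x y] by simp
  qed
  then show thesis
    using that[of f f' \<mu>] fd f_le f'_le by (simp add: f'_def)
qed


section \<open>Sums of independent random variables\<close>

text \<open>The members need not be identically distributed: during the replacement some coordinates
  are already Gaussian and others are not. Sums stay unnormalised, with variance
  \<open>card I\<close>.\<close>

locale unit_variance_family = prob_space M for M :: "'a measure" +
  fixes X :: "'i \<Rightarrow> 'a \<Rightarrow> real" and I :: "'i set" and \<rho> :: real
  assumes fin: "finite I"
    and indep: "indep_vars (\<lambda>_. borel) X I"
    and integrable_cube: "\<And>i. i \<in> I \<Longrightarrow> integrable M (\<lambda>\<omega>. \<bar>X i \<omega>\<bar> ^ 3)"
    and mean: "\<And>i. i \<in> I \<Longrightarrow> expectation (X i) = 0"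
    and second_moment: "\<And>i. i \<in> I \<Longrightarrow> expectation (\<lambda>\<omega>. (X i \<omega>)\<^sup>2) = 1"
    and third_moment: "\<And>i. i \<in> I \<Longrightarrow> expectation (\<lambda>\<omega>. \<bar>X i \<omega>\<bar> ^ 3) \<le> \<rho>"
begin

definition S :: "'a \<Rightarrow> real" where
  "S \<omega> = (\<Sum>i\<in>I. X i \<omega>)"

lemma measurable_X: "i \<in> I \<Longrightarrow> X i \<in> borel_measurable M"
  using indep by (auto simp: indep_vars_def)

lemma measurable_S[measurable]: "S \<in> borel_measurable M"
  unfolding S_def[abs_def] using measurable_X by (intro borel_measurable_sum)

lemma integrable_square: "i \<in> I \<Longrightarrow> integrable M (\<lambda>\<omega>. (X i \<omega>)\<^sup>2)"
  using second_moment[of i] not_integrable_integral_eq[of M "\<lambda>\<omega>. (X i \<omega>)\<^sup>2"] by force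

lemma integrable_X: "i \<in> I \<Longrightarrow> integrable M (X i)"
  using square_integrable_imp_integrable[OF measurable_X integrable_square] .

lemma expectation_abs_le: "i \<in> I \<Longrightarrow> expectation (\<lambda>\<omega>. \<bar>X i \<omega>\<bar>) \<le> 1"
proof -
  assume i: "i \<in> I"
  have "expectation (\<lambda>\<omega>. \<bar>X i \<omega>\<bar>) \<le> expectation (\<lambda>\<omega>. (1 + (X i \<omega>)\<^sup>2) / 2)"
  proof (rule integral_mono)
    fix \<omega>
    show "\<bar>X i \<omega>\<bar> \<le> (1 + (X i \<omega>)\<^sup>2) / 2"
      using zero_le_power2[of "\<bar>X i \<omega>\<bar> - 1"] by (simp add: power2_eq_square algebra_simps abs_mult_self_eq)
  qed (use integrable_X[OF i] integrable_square[OF i] in auto)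
  then show ?thesis
    using integrable_square[OF i] second_moment[OF i] by (simp add: prob_space)
qed

text \<open>Removing \<open>X i\<close> from \<open>S\<close> leaves a sum over the other indices,
  which is independent of \<open>X i\<close>. With \<open>u\<close> the identity the product has
  mean 0; with \<open>u\<close> the square the factor is 1.\<close>

lemma indep_leave_one_out:
  fixes u v :: "real \<Rightarrow> real"
  assumes i: "i \<in> I" and u: "u \<in> borel_measurable borel" and v: "v \<in> borel_measurable borel"
    and iu: "integrable M (\<lambda>\<omega>. u (X i \<omega>))" and iv: "integrable M (\<lambda>\<omega>. v (S \<omega> - X i \<omega>))"
  shows "expectation (\<lambda>\<omega>. u (X i \<omega>) * v (S \<omega> - X i \<omega>))
      = expectation (\<lambda>\<omega>. u (X i \<omega>)) * expectation (\<lambda>\<omega>. v (S \<omega> - X i \<omega>))"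
    and "integrable M (\<lambda>\<omega>. u (X i \<omega>) * v (S \<omega> - X i \<omega>))"
proof -
  have S: "S \<omega> - X i \<omega> = (\<Sum>j\<in>I - {i}. X j \<omega>)" for \<omega>
    unfolding S_def using fin i by (simp add: sum_diff1)
  have "indep_var borel (X i) borel (\<lambda>\<omega>. \<Sum>j\<in>I - {i}. X j \<omega>)"
    using fin i indep by (intro indep_vars_sum) (auto simp: insert_absorb)
  then have uv: "indep_var borel (u \<circ> X i) borel (v \<circ> (\<lambda>\<omega>. S \<omega> - X i \<omega>))"
    unfolding S using u v by (rule indep_var_compose)
  then show "expectation (\<lambda>\<omega>. u (X i \<omega>) * v (S \<omega> - X i \<omega>))
      = expectation (\<lambda>\<omega>. u (X i \<omega>)) * expectation (\<lambda>\<omega>. v (S \<omega> - X i \<omega>))"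
    and "integrable M (\<lambda>\<omega>. u (X i \<omega>) * v (S \<omega> - X i \<omega>))"
    using indep_var_lebesgue_integral[OF uv] indep_var_integrable[OF uv] iu iv by (simp_all add: comp_def)
qed

lemma integrable_bounded:
  assumes "f \<in> borel_measurable M" "\<And>\<omega>. \<bar>f \<omega>\<bar> \<le> (B::real)"
  shows "integrable M f"
  using assms by (intro integrable_const_bound[of _ B]) auto

lemma integrable_X_bounded:
  assumes i: "i \<in> I" and "f \<in> borel_measurable M" "\<And>\<omega>. \<bar>f \<omega>\<bar> \<le> (B::real)"
  shows "integrable M (\<lambda>\<omega>. X i \<omega> * f \<omega>)"
proof (rule Bochner_Integration.integrable_bound)
  show "integrable M (\<lambda>\<omega>. B * X i \<omega>)" using integrable_X[OF i] by simp
  have "B \<ge> 0" using assms(3) abs_ge_zero order_trans by blast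
  then show "AE \<omega> in M. norm (X i \<omega> * f \<omega>) \<le> norm (B * X i \<omega>)"
    using assms(3) by (auto simp: abs_mult mult.commute intro!: mult_right_mono)
qed (use measurable_X[OF i] assms(2) in simp)

text \<open>The number \<open>\<mu>\<close> depends on \<open>h\<close> alone (it is the mean of \<open>h\<close> under the normal law), so
  two families of the same size can be compared through it.\<close>

lemma stein_bound:
  fixes f f' h :: "real \<Rightarrow> real"
  defines "s \<equiv> sqrt (real (card I))"
  assumes f: "\<And>x. (f has_real_derivative f' x) (at x)"
    and eq: "\<And>x. f' x = x * f x + h x - \<mu>"
    and fb: "\<And>x. \<bar>f x\<bar> \<le> 10" and f'b: "\<And>x. \<bar>f' x\<bar> \<le> 12"
    and f'l: "\<And>x y. \<bar>f' x - f' y\<bar> \<le> 23 * \<bar>x - y\<bar>"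
    and ne: "I \<noteq> {}"
  shows "\<bar>expectation (\<lambda>\<omega>. h (S \<omega> / s)) - \<mu>\<bar> \<le> 23 * (\<rho> + 1) / s"
proof -
  have card: "card I > 0" using fin ne by (simp add: card_gt_0_iff)
  then have s: "s > 0" "s\<^sup>2 = card I" by (auto simp: s_def)
  have fm[measurable]: "f \<in> borel_measurable borel"
    using f by (intro borel_measurable_continuous_onI)
      (auto intro: DERIV_continuous continuous_at_imp_continuous_on)
  have "continuous_on UNIV f'"
    by (rule lipschitz_on_continuous_on[OF lipschitz_onI[of UNIV f' 23]]) (use f'l in \<open>auto simp: dist_real_def\<close>)
  then have f'm[measurable]: "f' \<in> borel_measurable borel"
    by (rule borel_measurable_continuous_onI)
  note [measurable] = measurable_X
  \<comment> \<open>Expand \<open>f\<close> at \<open>?V\<close>, the normalised sum without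
    \<open>X i\<close>. The zeroth-order term vanishes and the first-order term is the mean of
    \<open>f' (?V \<omega>)\<close> divided by \<open>s\<close>; the remainder uses third moments.
    Passing from \<open>?V\<close> back to \<open>?W\<close> in \<open>f'\<close> costs a first
    absolute moment, whence \<open>\<rho> + 1\<close>.\<close>
  have ie: "\<bar>s * expectation (\<lambda>\<omega>. X i \<omega> * f (S \<omega> / s)) - expectation (\<lambda>\<omega>. f' (S \<omega> / s))\<bar>
      \<le> 23 * (\<rho> + 1) / s" if i: "i \<in> I" for i
  proof -
    note [measurable] = measurable_X[OF i]
    let ?W = "\<lambda>\<omega>. S \<omega> / s" and ?V = "\<lambda>\<omega>. (S \<omega> - X i \<omega>) / s"
    have i1: "integrable M (\<lambda>\<omega>. X i \<omega> * f (?W \<omega>))"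
      by (rule integrable_X_bounded[OF i _ fb]) simp
    have i2: "integrable M (\<lambda>\<omega>. X i \<omega> * f (?V \<omega>))"
      by (rule integrable_X_bounded[OF i _ fb]) simp
    have i3: "integrable M (\<lambda>\<omega>. f' (?W \<omega>))" and i4: "integrable M (\<lambda>\<omega>. f' (?V \<omega>))"
      by (rule integrable_bounded[OF _ f'b]; simp)+
    have i4': "integrable M (\<lambda>\<omega>. f (?V \<omega>))"
      by (rule integrable_bounded[OF _ fb]; simp)
    have z1: "expectation (\<lambda>\<omega>. X i \<omega> * f (?V \<omega>)) = 0"
      using indep_leave_one_out(1)[OF i, of "\<lambda>x. x" "\<lambda>x. f (x / s)"] integrable_X[OF i] i4' mean[OF i]
      by simp
    have i5: "integrable M (\<lambda>\<omega>. (X i \<omega>)\<^sup>2 * f' (?V \<omega>))"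
      and z2: "expectation (\<lambda>\<omega>. (X i \<omega>)\<^sup>2 * f' (?V \<omega>)) = expectation (\<lambda>\<omega>. f' (?V \<omega>))"
      using indep_leave_one_out[OF i, of "\<lambda>x. x\<^sup>2" "\<lambda>x. f' (x / s)"] integrable_square[OF i] i4
        second_moment[OF i] by simp_all
    have ptw: "\<bar>X i \<omega> * (f (?W \<omega>) - f (?V \<omega>)) - (X i \<omega>)\<^sup>2 * f' (?V \<omega>) / s\<bar> \<le> 23 * \<bar>X i \<omega>\<bar> ^ 3 / s\<^sup>2" for \<omega>
    proof -
      have "norm (f (?W \<omega>) - f (?V \<omega>) - f' (?V \<omega>) * (?W \<omega> - ?V \<omega>)) \<le> (23 * \<bar>?W \<omega> - ?V \<omega>\<bar>) * norm (?W \<omega> - ?V \<omega>)"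
      proof -
        define a b where "a = ?V \<omega>" and "b = ?W \<omega>"
        \<comment> \<open>Subtracting the tangent at \<open>a\<close> leaves a function whose
          derivative on the segment is at most \<open>23 * \<bar>b - a\<bar>\<close>: a quadratic
          Taylor remainder without a second derivative.\<close>
        have "norm ((f b - f' a * b) - (f a - f' a * a)) \<le> (23 * \<bar>b - a\<bar>) * norm (b - a)"
        proof (rule field_differentiable_bound[of "closed_segment a b" _ "\<lambda>x. f' x - f' a"])
          fix z assume z: "z \<in> closed_segment a b"
          show "((\<lambda>x. f x - f' a * x) has_real_derivative f' z - f' a) (at z within closed_segment a b)"
            by (auto intro!: derivative_eq_intros f[THEN DERIV_cong] intro: has_field_derivative_at_within)
          have "\<bar>z - a\<bar> \<le> \<bar>b - a\<bar>"
            using z by (auto simp: closed_segment_eq_real_ivl split: if_splits)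
          then show "norm (f' z - f' a) \<le> 23 * \<bar>b - a\<bar>"
            using f'l[of z a] by simp
        qed auto
        then show ?thesis
          by (simp add: a_def b_def algebra_simps)
      qed
      moreover have "?W \<omega> - ?V \<omega> = X i \<omega> / s"
        by (simp add: diff_divide_distrib)
      ultimately have *: "\<bar>f (?W \<omega>) - f (?V \<omega>) - f' (?V \<omega>) * (X i \<omega> / s)\<bar> \<le> 23 * \<bar>X i \<omega> / s\<bar> * \<bar>X i \<omega> / s\<bar>"
        by simp
      have "\<bar>X i \<omega> * (f (?W \<omega>) - f (?V \<omega>)) - (X i \<omega>)\<^sup>2 * f' (?V \<omega>) / s\<bar>
          = \<bar>X i \<omega>\<bar> * \<bar>f (?W \<omega>) - f (?V \<omega>) - f' (?V \<omega>) * (X i \<omega> / s)\<bar>"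
        by (simp add: abs_mult[symmetric] algebra_simps power2_eq_square)
      also have "\<dots> \<le> \<bar>X i \<omega>\<bar> * (23 * \<bar>X i \<omega> / s\<bar> * \<bar>X i \<omega> / s\<bar>)"
        using * by (rule mult_left_mono) simp
      also have "\<dots> = 23 * \<bar>X i \<omega>\<bar> ^ 3 / s\<^sup>2"
        using s(1) by (simp add: power2_eq_square power3_eq_cube)
      finally show ?thesis .
    qed
    have "\<bar>expectation (\<lambda>\<omega>. X i \<omega> * f (?W \<omega>)) - expectation (\<lambda>\<omega>. f' (?V \<omega>)) / s\<bar>
        = \<bar>expectation (\<lambda>\<omega>. X i \<omega> * (f (?W \<omega>) - f (?V \<omega>)) - (X i \<omega>)\<^sup>2 * f' (?V \<omega>) / s)\<bar>"
      using i1 i2 i5 z1 z2 by (simp add: right_diff_distrib)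
    also have "\<dots> \<le> expectation (\<lambda>\<omega>. 23 * \<bar>X i \<omega>\<bar> ^ 3 / s\<^sup>2)"
      using i1 i2 i5 integrable_cube[OF i] ptw
      by (intro order_trans[OF integral_abs_bound integral_mono]) (auto simp: right_diff_distrib)
    also have "\<dots> \<le> 23 * \<rho> / s\<^sup>2"
      using third_moment[OF i] by (simp add: divide_right_mono)
    finally have A: "\<bar>expectation (\<lambda>\<omega>. X i \<omega> * f (?W \<omega>)) - expectation (\<lambda>\<omega>. f' (?V \<omega>)) / s\<bar> \<le> 23 * \<rho> / s\<^sup>2" .
    have ptw': "\<bar>f' (?V \<omega>) - f' (?W \<omega>)\<bar> \<le> 23 * \<bar>X i \<omega>\<bar> / s" for \<omega>
      using f'l[of "?V \<omega>" "?W \<omega>"] s(1) by (simp add: diff_divide_distrib)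
    have "\<bar>expectation (\<lambda>\<omega>. f' (?V \<omega>)) - expectation (\<lambda>\<omega>. f' (?W \<omega>))\<bar>
        = \<bar>expectation (\<lambda>\<omega>. f' (?V \<omega>) - f' (?W \<omega>))\<bar>"
      using i3 i4 by simp
    also have "\<dots> \<le> expectation (\<lambda>\<omega>. 23 * \<bar>X i \<omega>\<bar> / s)"
      using i3 i4 integrable_X[OF i] ptw'
      by (intro order_trans[OF integral_abs_bound integral_mono]) auto
    also have "\<dots> \<le> 23 / s"
      using expectation_abs_le[OF i] s(1) by (simp add: divide_right_mono)
    finally have B: "\<bar>expectation (\<lambda>\<omega>. f' (?V \<omega>)) - expectation (\<lambda>\<omega>. f' (?W \<omega>))\<bar> \<le> 23 / s" .
    have "\<bar>s * expectation (\<lambda>\<omega>. X i \<omega> * f (?W \<omega>)) - expectation (\<lambda>\<omega>. f' (?V \<omega>))\<bar>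
        = s * \<bar>expectation (\<lambda>\<omega>. X i \<omega> * f (?W \<omega>)) - expectation (\<lambda>\<omega>. f' (?V \<omega>)) / s\<bar>"
    proof -
      have "s * a - b = s * (a - b / s)" for a b
        using s(1) by (simp add: right_diff_distrib)
      then show ?thesis using s(1) by (simp add: abs_mult)
    qed
    also have "\<dots> \<le> s * (23 * \<rho> / s\<^sup>2)"
      using A s(1) by (intro mult_left_mono) auto
    also have "\<dots> = 23 * \<rho> / s"
      using s(1) by (simp add: power2_eq_square)
    finally show ?thesis
      using B by (simp add: distrib_left add_divide_distrib)
  qed
  have iX: "integrable M (\<lambda>\<omega>. X i \<omega> * f (S \<omega> / s))" if "i \<in> I" for i
    by (rule integrable_X_bounded[OF that _ fb]) simp
  have iW: "integrable M (\<lambda>\<omega>. f' (S \<omega> / s))"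
    by (rule integrable_bounded[OF _ f'b]) simp
  have h: "h (S \<omega> / s) = f' (S \<omega> / s) - (\<Sum>i\<in>I. X i \<omega> * f (S \<omega> / s)) / s + \<mu>" for \<omega>
    using eq[of "S \<omega> / s"] by (simp add: S_def sum_distrib_right sum_divide_distrib)
  have "expectation (\<lambda>\<omega>. h (S \<omega> / s)) - \<mu>
      = expectation (\<lambda>\<omega>. f' (S \<omega> / s)) - (\<Sum>i\<in>I. expectation (\<lambda>\<omega>. X i \<omega> * f (S \<omega> / s))) / s"
    unfolding h using iX iW by (simp add: prob_space)
  \<comment> \<open>As \<open>s\<^sup>2 = card I\<close>, the total error is the average of the
    errors of the single indices, so it obeys the same bound.\<close>
  also have "\<dots> = - (\<Sum>i\<in>I. s * expectation (\<lambda>\<omega>. X i \<omega> * f (S \<omega> / s)) - expectation (\<lambda>\<omega>. f' (S \<omega> / s))) / s\<^sup>2"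
    using s(1) by (simp add: sum_subtractf sum_distrib_left[symmetric] s(2)[symmetric] power2_eq_square field_simps)
  also have "\<bar>\<dots>\<bar> \<le> (\<Sum>i\<in>I. 23 * (\<rho> + 1) / s) / s\<^sup>2"
  proof -
    have "\<bar>\<Sum>i\<in>I. s * expectation (\<lambda>\<omega>. X i \<omega> * f (S \<omega> / s)) - expectation (\<lambda>\<omega>. f' (S \<omega> / s))\<bar>
        \<le> (\<Sum>i\<in>I. 23 * (\<rho> + 1) / s)"
      by (rule order_trans[OF sum_abs sum_mono]) (rule ie)
    then show ?thesis
      unfolding abs_divide abs_minus_cancel by (simp only: abs_power2) (rule divide_right_mono, auto)
  qed
  also have "\<dots> = 23 * (\<rho> + 1) / s"
    using s card by simp
  finally show ?thesis .
qed

end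


section \<open>Second moments of independent sums and their concentration function\<close>

lemma (in prob_space) expectation_square_sum_indep:
  fixes Y :: "'i \<Rightarrow> 'a \<Rightarrow> real"
  assumes "finite I" "indep_vars (\<lambda>_. borel) Y I"
    and "\<And>i. i \<in> I \<Longrightarrow> integrable M (\<lambda>\<omega>. (Y i \<omega>)\<^sup>2)"
    and "\<And>i. i \<in> I \<Longrightarrow> expectation (Y i) = 0"
  shows "integrable M (\<lambda>\<omega>. (\<Sum>i\<in>I. Y i \<omega>)\<^sup>2) \<and>
    expectation (\<lambda>\<omega>. (\<Sum>i\<in>I. Y i \<omega>)\<^sup>2) = (\<Sum>i\<in>I. expectation (\<lambda>\<omega>. (Y i \<omega>)\<^sup>2))"
  using assms
proof (induction I rule: finite_induct)
  case (insert i I)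
  let ?T = "\<lambda>\<omega>. \<Sum>j\<in>I. Y j \<omega>"
  have rv: "j \<in> insert i I \<Longrightarrow> Y j \<in> borel_measurable M" for j
    using insert.prems(1) by (auto simp: indep_vars_def)
  have iY: "j \<in> insert i I \<Longrightarrow> integrable M (Y j)" for j
    using square_integrable_imp_integrable[OF rv insert.prems(2)] .
  have "indep_vars (\<lambda>_. borel) Y I"
    using insert.prems(1) by (rule indep_vars_subset) auto
  note IH = insert.IH[OF this insert.prems(2,3)]
  have iT: "integrable M ?T"
    using iY by auto
  have ind: "indep_var borel (Y i) borel ?T"
    using insert by (intro indep_vars_sum) auto
  have iYT: "integrable M (\<lambda>\<omega>. Y i \<omega> * ?T \<omega>)" and "expectation (\<lambda>\<omega>. Y i \<omega> * ?T \<omega>) = 0"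
    using indep_var_integrable[OF ind] indep_var_lebesgue_integral[OF ind] iY iT insert.prems(3)[of i]
    by simp_all
  moreover have "(\<Sum>j\<in>insert i I. Y j \<omega>)\<^sup>2 = (Y i \<omega>)\<^sup>2 + 2 * (Y i \<omega> * ?T \<omega>) + (?T \<omega>)\<^sup>2" for \<omega>
    using insert by (simp add: power2_sum)
  ultimately show "integrable M (\<lambda>\<omega>. (\<Sum>j\<in>insert i I. Y j \<omega>)\<^sup>2) \<and>
    expectation (\<lambda>\<omega>. (\<Sum>j\<in>insert i I. Y j \<omega>)\<^sup>2) = (\<Sum>j\<in>insert i I. expectation (\<lambda>\<omega>. (Y j \<omega>)\<^sup>2))"
    using insert IH insert.prems(2)[of i] by simp_all
qed (simp_all add: prob_space)

context unit_variance_family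
begin

text \<open>The concentration inequality of Chen and Shao: testing \<open>S\<close> against a clamped linear
  function \<open>f\<close> bounds \<open>E S f(S) = \<Sum> E X\<^sub>i (f(S) - f(S - X\<^sub>i))\<close> from above by
  \<open>O(sqrt n)\<close>, while each summand on the right is nonnegative and dominates
  \<open>\<bar>X\<^sub>i\<bar> min \<bar>X\<^sub>i\<bar> \<delta>\<close> as soon as \<open>S\<close> lies in the given interval.\<close>

lemma concentration:
  assumes ne: "I \<noteq> {}" and rho: "\<rho> > 0"
  shows "prob {\<omega> \<in> space M. a \<le> S \<omega> \<and> S \<omega> \<le> a + 1} \<le> (2 + 8 * \<rho> + 64 * \<rho>\<^sup>2) / sqrt (real (card I))"
proof -
  define N where "N = real (card I)"
  have N: "N \<ge> 1" using fin ne by (auto simp: N_def Suc_leI card_gt_0_iff)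
  \<comment> \<open>This truncation level makes \<open>1 - \<rho> / \<delta>\<close> equal to
    \<open>1 / 2\<close>, so the truncated squares \<open>u (X i \<omega>)\<close> keep at least
    half of the second moment.\<close>
  define \<delta> where "\<delta> = 2 * \<rho>"
  have \<delta>: "\<delta> > 0" using rho by (simp add: \<delta>_def)
  define u where "u x = \<bar>x\<bar> * min \<bar>x\<bar> \<delta>" for x :: real
  define U where "U \<omega> = (\<Sum>i\<in>I. u (X i \<omega>))" for \<omega>
  have um[measurable]: "u \<in> borel_measurable borel" unfolding u_def[abs_def] by measurable
  have u_le: "0 \<le> u x" "u x \<le> \<delta> * \<bar>x\<bar>" "x\<^sup>2 - \<bar>x\<bar> ^ 3 / \<delta> \<le> u x" for x
  proof -
    show "0 \<le> u x" "u x \<le> \<delta> * \<bar>x\<bar>"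
      using \<delta> by (auto simp: u_def mult.commute[of \<delta>] intro!: mult_left_mono)
    show "x\<^sup>2 - \<bar>x\<bar> ^ 3 / \<delta> \<le> u x"
    proof (cases "\<bar>x\<bar> \<le> \<delta>")
      case True
      then show ?thesis using \<delta> by (simp add: u_def power2_eq_square)
    next
      case False
      then have "\<delta> * x\<^sup>2 \<le> \<bar>x\<bar> * x\<^sup>2" by (intro mult_right_mono) auto
      then have "x\<^sup>2 \<le> \<bar>x\<bar> ^ 3 / \<delta>"
        using \<delta> by (simp add: field_simps power2_eq_square power3_eq_cube)
      then show ?thesis using \<open>0 \<le> u x\<close> by simp
    qed
  qed
  note [measurable] = measurable_X
  have Um[measurable]: "U \<in> borel_measurable M"
    unfolding U_def[abs_def] by (intro borel_measurable_sum measurable_compose[OF measurable_X um])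
  have iu2: "integrable M (\<lambda>\<omega>. (u (X i \<omega>))\<^sup>2)" "expectation (\<lambda>\<omega>. (u (X i \<omega>))\<^sup>2) \<le> \<delta>\<^sup>2" if i: "i \<in> I" for i
  proof -
    have b: "(u x)\<^sup>2 \<le> \<delta>\<^sup>2 * x\<^sup>2" for x
      using power_mono[OF u_le(2) u_le(1), of x 2] by (simp add: power_mult_distrib)
    show *: "integrable M (\<lambda>\<omega>. (u (X i \<omega>))\<^sup>2)"
      by (rule Bochner_Integration.integrable_bound[of M "\<lambda>\<omega>. \<delta>\<^sup>2 * (X i \<omega>)\<^sup>2"])
         (use integrable_square[OF i] measurable_X[OF i] b in auto)
    show "expectation (\<lambda>\<omega>. (u (X i \<omega>))\<^sup>2) \<le> \<delta>\<^sup>2"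
      using integral_mono[OF * _ b] integrable_square[OF i] second_moment[OF i] by simp
  qed
  have iu: "integrable M (\<lambda>\<omega>. u (X i \<omega>))" if i: "i \<in> I" for i
    using square_integrable_imp_integrable[OF _ iu2(1)[OF i]] measurable_X[OF i] by simp
  have eu: "expectation (\<lambda>\<omega>. u (X i \<omega>)) \<ge> 1 / 2" if i: "i \<in> I" for i
  proof -
    have "expectation (\<lambda>\<omega>. (X i \<omega>)\<^sup>2 - \<bar>X i \<omega>\<bar> ^ 3 / \<delta>) \<le> expectation (\<lambda>\<omega>. u (X i \<omega>))"
      using integrable_square[OF i] integrable_cube[OF i] iu[OF i] u_le(3) by (intro integral_mono) auto
    moreover have "expectation (\<lambda>\<omega>. (X i \<omega>)\<^sup>2 - \<bar>X i \<omega>\<bar> ^ 3 / \<delta>)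
        = 1 - expectation (\<lambda>\<omega>. \<bar>X i \<omega>\<bar> ^ 3) / \<delta>"
      using integrable_square[OF i] integrable_cube[OF i] second_moment[OF i] by simp
    moreover have "expectation (\<lambda>\<omega>. \<bar>X i \<omega>\<bar> ^ 3) / \<delta> \<le> \<rho> / \<delta>"
      using third_moment[OF i] \<delta> by (intro divide_right_mono) auto
    moreover have "\<rho> / \<delta> = 1 / 2" using rho by (simp add: \<delta>_def)
    ultimately show ?thesis by linarith
  qed
  define Y where "Y i \<omega> = u (X i \<omega>) - expectation (\<lambda>\<omega>. u (X i \<omega>))" for i \<omega>
  have indY: "indep_vars (\<lambda>_. borel) Y I"
    unfolding Y_def by (rule indep_vars_compose2[OF indep]) measurable
  have Y2: "integrable M (\<lambda>\<omega>. (Y i \<omega>)\<^sup>2)" "expectation (Y i) = 0" "expectation (\<lambda>\<omega>. (Y i \<omega>)\<^sup>2) \<le> \<delta>\<^sup>2" if i: "i \<in> I" for i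
  proof -
    show "expectation (Y i) = 0"
      unfolding Y_def[abs_def] using iu[OF i] by (simp add: prob_space)
    show "integrable M (\<lambda>\<omega>. (Y i \<omega>)\<^sup>2)"
      unfolding Y_def power2_diff using iu[OF i] iu2(1)[OF i] by auto
    have "expectation (\<lambda>\<omega>. (Y i \<omega>)\<^sup>2) = expectation (\<lambda>\<omega>. (u (X i \<omega>))\<^sup>2) - (expectation (\<lambda>\<omega>. u (X i \<omega>)))\<^sup>2"
      unfolding Y_def using iu[OF i] iu2(1)[OF i] by (rule variance_eq)
    then show "expectation (\<lambda>\<omega>. (Y i \<omega>)\<^sup>2) \<le> \<delta>\<^sup>2"
      using iu2(2)[OF i] zero_le_power2[of "expectation (\<lambda>\<omega>. u (X i \<omega>))"] by linarith
  qed
  \<comment> \<open>Chebyshev: \<open>U\<close> has mean at least \<open>N / 2\<close> and variance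
    at most \<open>N * \<delta>\<^sup>2\<close>, so falling below \<open>N / 4\<close> is a
    deviation of at least \<open>N / 4\<close>. Truncation is what gives \<open>U\<close> a finite
    variance from third moments alone.\<close>
  have "prob {\<omega> \<in> space M. N / 4 \<le> \<bar>\<Sum>i\<in>I. Y i \<omega>\<bar>} \<le> expectation (\<lambda>\<omega>. (\<Sum>i\<in>I. Y i \<omega>)\<^sup>2) / (N / 4)\<^sup>2"
    using expectation_square_sum_indep[OF fin indY Y2(1,2)] N indY
    by (intro second_moment_method borel_measurable_sum) (auto simp: indep_vars_def)
  also have "expectation (\<lambda>\<omega>. (\<Sum>i\<in>I. Y i \<omega>)\<^sup>2) \<le> N * \<delta>\<^sup>2"
    using expectation_square_sum_indep[OF fin indY Y2(1,2)]
      sum_bounded_above[of I "\<lambda>i. expectation (\<lambda>\<omega>. (Y i \<omega>)\<^sup>2)" "\<delta>\<^sup>2", OF Y2(3)]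
    by (simp add: N_def)
  also have "N * \<delta>\<^sup>2 / (N / 4)\<^sup>2 = 64 * \<rho>\<^sup>2 / N"
    using N by (simp add: \<delta>_def power2_eq_square field_simps)
  finally have "prob {\<omega> \<in> space M. N / 4 \<le> \<bar>\<Sum>i\<in>I. Y i \<omega>\<bar>} \<le> 64 * \<rho>\<^sup>2 / N"
    by (simp add: divide_right_mono)
  moreover have "prob {\<omega> \<in> space M. U \<omega> < N / 4} \<le> prob {\<omega> \<in> space M. N / 4 \<le> \<bar>\<Sum>i\<in>I. Y i \<omega>\<bar>}"
  proof (rule finite_measure_mono)
    have "(\<Sum>i\<in>I. Y i \<omega>) \<le> U \<omega> - N / 2" for \<omega>
      using sum_bounded_below[of I "1/2" "\<lambda>i. expectation (\<lambda>\<omega>. u (X i \<omega>))"] eu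
      by (simp add: Y_def U_def sum_subtractf N_def)
    then show "{\<omega> \<in> space M. U \<omega> < N / 4} \<subseteq> {\<omega> \<in> space M. N / 4 \<le> \<bar>\<Sum>i\<in>I. Y i \<omega>\<bar>}"
      by (auto, smt (verit, best) field_sum_of_halves)
    have [measurable]: "i \<in> I \<Longrightarrow> Y i \<in> borel_measurable M" for i
      using indY by (auto simp: indep_vars_def)
    show "{\<omega> \<in> space M. N / 4 \<le> \<bar>\<Sum>i\<in>I. Y i \<omega>\<bar>} \<in> events" by measurable
  qed
  ultimately have small: "prob {\<omega> \<in> space M. U \<omega> < N / 4} \<le> 64 * \<rho>\<^sup>2 / N" by linarith

  \<comment> \<open>Half the length of the interval plus the truncation level: from any point of the
    interval, \<open>f\<close> then has slope 1 over distance \<open>\<delta>\<close> on either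
    side.\<close>
  define B where "B = 1 / 2 + \<delta>"
  have B: "B > 0" using \<delta> by (simp add: B_def)
  define f where "f s = max (- B) (min B (s - a - 1 / 2))" for s
  have fm[measurable]: "f \<in> borel_measurable borel" unfolding f_def[abs_def] by measurable
  have fb: "\<bar>f s\<bar> \<le> B" for s using B by (auto simp: f_def)
  have mono: "0 \<le> x * (f s - f (s - x))" for x s
    by (cases "x \<ge> 0") (auto simp: f_def intro!: mult_nonneg_nonneg mult_nonpos_nonpos)
  have dom: "u x \<le> x * (f s - f (s - x))" if "a \<le> s" "s \<le> a + 1" for x s
  proof (cases "x \<ge> 0")
    case True
    have "min \<bar>x\<bar> \<delta> \<le> f s - f (s - x)" using that True by (auto simp: f_def B_def)
    then show ?thesis using True by (simp add: u_def mult_left_mono)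
  next
    case False
    have "min \<bar>x\<bar> \<delta> \<le> f (s - x) - f s" using that False by (auto simp: f_def B_def)
    then have "\<bar>x\<bar> * min \<bar>x\<bar> \<delta> \<le> \<bar>x\<bar> * (f (s - x) - f s)" by (rule mult_left_mono) simp
    then show ?thesis using False by (simp add: u_def algebra_simps)
  qed
  define A where "A = {\<omega> \<in> space M. a \<le> S \<omega> \<and> S \<omega> \<le> a + 1 \<and> N / 4 \<le> U \<omega>}"
  have Am[measurable]: "A \<in> events" unfolding A_def by measurable
  have i1: "integrable M (\<lambda>\<omega>. X i \<omega> * f (S \<omega>))" if "i \<in> I" for i
    by (rule integrable_X_bounded[OF that _ fb]) simp
  have i2: "integrable M (\<lambda>\<omega>. X i \<omega> * f (S \<omega> - X i \<omega>))" if i: "i \<in> I" for i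
    using measurable_X[OF i] by (intro integrable_X_bounded[OF i _ fb]) simp
  have iz: "integrable M (\<lambda>\<omega>. f (S \<omega> - X i \<omega>))" if i: "i \<in> I" for i
    using measurable_X[OF i] by (intro integrable_bounded[OF _ fb]) simp
  have z: "expectation (\<lambda>\<omega>. X i \<omega> * f (S \<omega> - X i \<omega>)) = 0" if i: "i \<in> I" for i
    using indep_leave_one_out(1)[OF i, of "\<lambda>x. x" f] integrable_X[OF i] mean[OF i] measurable_X[OF i]
      iz[OF i] by simp
  have "N / 4 * prob A = expectation (\<lambda>\<omega>. N / 4 * indicator A \<omega>)"
    by simp
  also have "\<dots> \<le> expectation (\<lambda>\<omega>. \<Sum>i\<in>I. X i \<omega> * (f (S \<omega>) - f (S \<omega> - X i \<omega>)))"
  proof (rule integral_mono)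
    show "integrable M (\<lambda>\<omega>. \<Sum>i\<in>I. X i \<omega> * (f (S \<omega>) - f (S \<omega> - X i \<omega>)))"
      using i1 i2 by (auto simp: right_diff_distrib)
    fix \<omega>
    show "N / 4 * indicator A \<omega> \<le> (\<Sum>i\<in>I. X i \<omega> * (f (S \<omega>) - f (S \<omega> - X i \<omega>)))"
    proof (cases "\<omega> \<in> A")
      case True
      then have "N / 4 \<le> U \<omega>" by (simp add: A_def)
      also have "U \<omega> \<le> (\<Sum>i\<in>I. X i \<omega> * (f (S \<omega>) - f (S \<omega> - X i \<omega>)))"
        unfolding U_def using True by (intro sum_mono dom) (auto simp: A_def)
      finally show ?thesis using True by simp
    qed (simp add: sum_nonneg mono)
  next
    show "integrable M (\<lambda>\<omega>. N / 4 * indicator A \<omega>)"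
      by (rule integrable_bounded[where B="N / 4"]) (use N in \<open>auto simp: indicator_def\<close>)
  qed
  also have "\<dots> = expectation (\<lambda>\<omega>. \<Sum>i\<in>I. X i \<omega> * f (S \<omega>))"
    using i1 i2 z by (simp add: right_diff_distrib)
  also have "\<dots> = expectation (\<lambda>\<omega>. S \<omega> * f (S \<omega>))"
    by (simp add: S_def sum_distrib_right)
  \<comment> \<open>The arithmetic-geometric mean inequality, balanced at \<open>sqrt N\<close>,
    replaces the mean of \<open>\<bar>S \<omega>\<bar>\<close> by the second moment
    \<open>N\<close>. The result \<open>B * sqrt N\<close>, divided by \<open>N / 4\<close>, yields
    \<open>4 * B = 2 + 8 * \<rho>\<close> in the constant.\<close>
  also have "\<dots> \<le> expectation (\<lambda>\<omega>. B / 2 * (sqrt N + (S \<omega>)\<^sup>2 / sqrt N))"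
  proof (rule integral_mono)
    have S2: "integrable M (\<lambda>\<omega>. (S \<omega>)\<^sup>2)"
      unfolding S_def using expectation_square_sum_indep[OF fin indep integrable_square mean] by blast
    then show "integrable M (\<lambda>\<omega>. B / 2 * (sqrt N + (S \<omega>)\<^sup>2 / sqrt N))" by auto
    show "integrable M (\<lambda>\<omega>. S \<omega> * f (S \<omega>))"
      using i1 by (simp add: S_def sum_distrib_right)
    fix \<omega>
    have "S \<omega> * f (S \<omega>) \<le> \<bar>S \<omega>\<bar> * \<bar>f (S \<omega>)\<bar>" by (metis abs_ge_self abs_mult)
    also have "\<dots> \<le> \<bar>S \<omega>\<bar> * B" by (intro mult_left_mono fb) simp
    also have "\<bar>S \<omega>\<bar> \<le> (sqrt N + (S \<omega>)\<^sup>2 / sqrt N) / 2"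
      using zero_le_power2[of "\<bar>S \<omega>\<bar> - sqrt N"] N by (simp add: power2_diff field_simps power2_eq_square)
    finally show "S \<omega> * f (S \<omega>) \<le> B / 2 * (sqrt N + (S \<omega>)\<^sup>2 / sqrt N)"
      using B by (simp add: mult_ac)
  qed
  also have "\<dots> = B / 2 * (sqrt N + N / sqrt N)"
    using expectation_square_sum_indep[OF fin indep integrable_square mean] second_moment
    by (simp add: S_def prob_space N_def)
  also have "\<dots> = B * sqrt N"
    using N by (simp add: real_div_sqrt)
  finally have "N / 4 * prob A \<le> B * sqrt N" .
  then have "prob A \<le> 4 * B * (sqrt N / N)"
    using N by (simp add: field_simps)
  also have "sqrt N / N = 1 / sqrt N"
    using N by (simp add: field_simps)
  finally have A: "prob A \<le> 4 * B / sqrt N" by simp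
  have "prob {\<omega> \<in> space M. a \<le> S \<omega> \<and> S \<omega> \<le> a + 1} \<le> prob (A \<union> {\<omega> \<in> space M. U \<omega> < N / 4})"
    by (intro finite_measure_mono) (auto simp: A_def)
  also have "\<dots> \<le> prob A + prob {\<omega> \<in> space M. U \<omega> < N / 4}"
    by (intro measure_Un_le) auto
  also have "\<dots> \<le> 4 * B / sqrt N + 64 * \<rho>\<^sup>2 / sqrt N"
  proof -
    have "sqrt N \<le> N" using N by (simp add: real_le_lsqrt power2_eq_square)
    then have "64 * \<rho>\<^sup>2 / N \<le> 64 * \<rho>\<^sup>2 / sqrt N" using N by (intro divide_left_mono) auto
    then show ?thesis using A small by linarith
  qed
  also have "\<dots> = (2 + 8 * \<rho> + 64 * \<rho>\<^sup>2) / sqrt N"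
    by (simp add: B_def \<delta>_def add_divide_distrib)
  finally show ?thesis by (simp add: N_def)
qed

end


section \<open>Products of normalized laws\<close>

text \<open>An upper bound \<open>\<rho>\<close>, rather than the third moment itself, lets one
  number serve the given law, the normal law and every mixed product of the two.\<close>

definition normalized_law :: "real \<Rightarrow> real measure \<Rightarrow> bool" where
  "normalized_law \<rho> D \<longleftrightarrow> real_distribution D \<and> integrable D (\<lambda>t. \<bar>t\<bar> ^ 3) \<and>
     (\<integral>t. t \<partial>D) = 0 \<and> (\<integral>t. t\<^sup>2 \<partial>D) = 1 \<and> (\<integral>t. \<bar>t\<bar> ^ 3 \<partial>D) \<le> \<rho>"

lemma prob_space_normalized_law: "normalized_law \<rho> D \<Longrightarrow> prob_space D"
  by (auto simp: normalized_law_def real_distribution_def)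

lemma sets_normalized_law: "normalized_law \<rho> D \<Longrightarrow> sets D = sets borel"
  by (auto simp: normalized_law_def real_distribution_def real_distribution_axioms_def)

lemma indep_vars_PiM_coordinates:
  assumes "finite I" and D: "\<And>i. prob_space (D i)" and "\<And>i. sets (D i) = sets borel"
  shows "prob_space.indep_vars (PiM I D) (\<lambda>_. borel) (\<lambda>i x. x i) I"
proof (cases "I = {}")
  case True
  interpret prob_space "PiM I D" by (intro prob_space_PiM D)
  show ?thesis by (unfold indep_vars_def indep_sets_def) (simp add: True)
next
  case False
  interpret prob_space "PiM I D" by (intro prob_space_PiM D)
  have m: "i \<in> I \<Longrightarrow> (\<lambda>x. x i) \<in> measurable (PiM I D) borel" for i
    using measurable_component_singleton[of i I D] assms(3)[of i] measurable_cong_sets by blast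
  have sets: "sets (PiM I D) = sets (PiM I (\<lambda>_. borel))"
    by (intro sets_PiM_cong) (auto simp: assms)
  have "distr (PiM I D) borel (\<lambda>x. x i) = D i" if "i \<in> I" for i
  proof -
    have "distr (PiM I D) borel (\<lambda>x. x i) = distr (PiM I D) (D i) (\<lambda>x. x i)"
      by (rule distr_cong) (simp_all add: assms(3))
    then show ?thesis using distr_PiM_component[OF D that] by simp
  qed
  then have "PiM I (\<lambda>i. distr (PiM I D) borel (\<lambda>x. x i)) = PiM I D"
    by (intro PiM_cong) auto
  moreover have "distr (PiM I D) (PiM I (\<lambda>_. borel)) (\<lambda>x. \<lambda>i\<in>I. x i) = distr (PiM I D) (PiM I D) (\<lambda>x. x)"
    by (rule distr_cong[OF refl sets[symmetric]]) (simp add: space_PiM PiE_def extensional_restrict)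
  ultimately show ?thesis
    using indep_vars_iff_distr_eq_PiM'[OF False m] by (simp add: distr_id)
qed

text \<open>Signs preserve the vanishing mean, the squares and the absolute third moments, so each
  signed row sum falls under the concentration bound with the same \<open>\<rho>\<close>.\<close>

lemma unit_variance_family_PiM:
  assumes fin: "finite I" and D: "\<And>i. normalized_law \<rho> (D i)"
    and a: "\<And>i. i \<in> I \<Longrightarrow> a i \<in> {-1, 1 :: real}"
  shows "unit_variance_family (PiM I D) (\<lambda>i x. a i * x i) I \<rho>"
proof -
  note pD = prob_space_normalized_law[OF D] and sD = sets_normalized_law[OF D]
  interpret prob_space "PiM I D" by (intro prob_space_PiM pD)
  have m: "i \<in> I \<Longrightarrow> (\<lambda>x. x i) \<in> measurable (PiM I D) (D i)" for i
    by (rule measurable_component_singleton)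
  have coord: "integrable (PiM I D) (\<lambda>x. g (x i)) \<longleftrightarrow> integrable (D i) g"
    "expectation (\<lambda>x. g (x i)) = (\<integral>t. g t \<partial>D i)"
    if i: "i \<in> I" and g: "g \<in> borel_measurable borel" for i and g :: "real \<Rightarrow> real"
  proof -
    have g': "g \<in> borel_measurable (D i)" using g sD[of i] measurable_cong_sets by blast
    show "integrable (PiM I D) (\<lambda>x. g (x i)) \<longleftrightarrow> integrable (D i) g"
      using integrable_distr_eq[OF m[OF i] g'] distr_PiM_component[of I D i] pD i by simp
    show "expectation (\<lambda>x. g (x i)) = (\<integral>t. g t \<partial>D i)"
      using integral_distr[OF m[OF i] g'] distr_PiM_component[of I D i] pD i by simp
  qed
  have abs_a: "\<bar>a i\<bar> = 1" "(a i)\<^sup>2 = 1" if "i \<in> I" for i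
    using a[OF that] by auto
  show ?thesis
  proof
    show "indep_vars (\<lambda>_. borel) (\<lambda>i x. a i * x i) I"
      by (rule indep_vars_compose2[OF indep_vars_PiM_coordinates[OF fin pD sD]]) measurable
    fix i assume i: "i \<in> I"
    show "integrable (PiM I D) (\<lambda>x. \<bar>a i * x i\<bar> ^ 3)"
      using coord(1)[OF i, of "\<lambda>t. \<bar>t\<bar> ^ 3"] D[of i] abs_a[OF i] by (simp add: abs_mult normalized_law_def)
    show "expectation (\<lambda>x. \<bar>a i * x i\<bar> ^ 3) \<le> \<rho>"
      using coord(2)[OF i, of "\<lambda>t. \<bar>t\<bar> ^ 3"] D[of i] abs_a[OF i] by (simp add: abs_mult normalized_law_def)
    show "expectation (\<lambda>x. a i * x i) = 0"
      using coord(2)[OF i, of "\<lambda>t. t"] D[of i] by (simp add: normalized_law_def)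
    show "expectation (\<lambda>x. (a i * x i)\<^sup>2) = 1"
      using coord(2)[OF i, of "\<lambda>t. t\<^sup>2"] D[of i] abs_a[OF i] by (simp add: power_mult_distrib normalized_law_def)
  qed (rule fin)
qed

text \<open>After rescaling \<open>h\<close> to a 1-Lipschitz function of the normalised sum,
  Stein's error \<open>23 * (\<rho> + 1) / s\<close> is multiplied by \<open>L * s\<close>; the
  block size cancels. Both laws are compared with the same \<open>\<mu>\<close>, which doubles 23 to
  46.\<close>

lemma block_sum_comparison:
  fixes h :: "real \<Rightarrow> real"
  assumes fin: "finite B" and D: "normalized_law \<rho> D" and N: "normalized_law \<rho> N"
    and L: "L > 0" and h: "\<And>x y. \<bar>h x - h y\<bar> \<le> L * \<bar>x - y\<bar>" and rho: "\<rho> > 0"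
  shows "\<bar>(\<integral>x. h (\<Sum>k\<in>B. x k) \<partial>PiM B (\<lambda>_. D)) - (\<integral>x. h (\<Sum>k\<in>B. x k) \<partial>PiM B (\<lambda>_. N))\<bar> \<le> 46 * (\<rho> + 1) * L"
proof (cases "B = {}")
  case True
  then show ?thesis
    using L rho by (simp add: PiM_empty lebesgue_integral_count_space_finite)
next
  case False
  define s where "s = sqrt (real (card B))"
  have s: "s > 0" using False fin by (simp add: s_def card_gt_0_iff)
  define g where "g w = h (s * w) / (L * s)" for w
  have "\<bar>g x - g y\<bar> \<le> \<bar>x - y\<bar>" for x y
  proof -
    have "\<bar>g x - g y\<bar> = \<bar>h (s * x) - h (s * y)\<bar> / (L * s)"
      using L s by (simp add: g_def diff_divide_distrib[symmetric] abs_divide)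
    also have "\<dots> \<le> (L * \<bar>s * x - s * y\<bar>) / (L * s)"
      using L s h by (intro divide_right_mono) auto
    also have "\<bar>s * x - s * y\<bar> = s * \<bar>x - y\<bar>"
      using s by (simp add: abs_mult right_diff_distrib[symmetric])
    finally show ?thesis using L s by simp
  qed
  then obtain f f' \<mu> where f: "\<And>x. (f has_real_derivative f' x) (at x)"
    "\<And>x. f' x = x * f x + g x - \<mu>" "\<And>x. \<bar>f x\<bar> \<le> 10" "\<And>x. \<bar>f' x\<bar> \<le> 12"
    "\<And>x y. \<bar>f' x - f' y\<bar> \<le> 23 * \<bar>x - y\<bar>"
    using stein_solution[of g] by blast
  have *: "\<bar>(\<integral>x. h (\<Sum>k\<in>B. x k) \<partial>PiM B (\<lambda>_. T)) - L * s * \<mu>\<bar> \<le> 23 * (\<rho> + 1) * L"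
    if T: "normalized_law \<rho> T" for T
  proof -
    interpret T: unit_variance_family "PiM B (\<lambda>_. T)" "\<lambda>k x. 1 * x k" B \<rho>
      using fin T by (intro unit_variance_family_PiM) auto
    have TS: "T.S = (\<lambda>x. \<Sum>k\<in>B. x k)"
      by (rule ext) (unfold T.S_def, simp)
    have "(\<integral>x. h (\<Sum>k\<in>B. x k) \<partial>PiM B (\<lambda>_. T)) = L * s * T.expectation (\<lambda>x. g (T.S x / s))"
      unfolding TS using L s by (simp add: g_def)
    then have "\<bar>(\<integral>x. h (\<Sum>k\<in>B. x k) \<partial>PiM B (\<lambda>_. T)) - L * s * \<mu>\<bar>
        = L * s * \<bar>T.expectation (\<lambda>x. g (T.S x / s)) - \<mu>\<bar>"
      using L s by (simp add: right_diff_distrib[symmetric] abs_mult)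
    also have "\<dots> \<le> L * s * (23 * (\<rho> + 1) / s)"
      using T.stein_bound[OF f False] L s by (intro mult_left_mono) (auto simp: s_def)
    finally show ?thesis using s by (simp add: mult_ac)
  qed
  from *[OF D] *[OF N] show ?thesis by (simp add: algebra_simps)
qed

section \<open>Regularisation of nearly Lipschitz functions and covering by unit intervals\<close>

text \<open>The sup-convolution of \<open>H\<close> with the cone of slope \<open>L\<close> is its
  least \<open>L\<close>-Lipschitz majorant. The slack \<open>+ 1\<close> in the hypothesis becomes
  the loss \<open>L\<close>.\<close>

lemma lipschitz_envelope:
  fixes H :: "real \<Rightarrow> real"
  assumes H1: "\<And>x. 0 \<le> H x" "\<And>x. H x \<le> 1" and L: "0 \<le> L"
    and HL: "\<And>x y. H x \<le> H y + L * (\<bar>x - y\<bar> + 1)"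
  obtains h where "\<And>x y. \<bar>h x - h y\<bar> \<le> L * \<bar>x - y\<bar>"
    and "\<And>x. H x \<le> h x" and "\<And>x. h x \<le> H x + L"
proof -
  define h where "h x = (SUP y. H y - L * \<bar>x - y\<bar>)" for x
  have bdd: "bdd_above (range (\<lambda>y. H y - L * \<bar>x - y\<bar>))" for x
  proof (rule bdd_aboveI2)
    show "H y - L * \<bar>x - y\<bar> \<le> 1" for y
      using H1(2)[of y] mult_nonneg_nonneg[OF L abs_ge_zero[of "x - y"]] by linarith
  qed
  have up: "H y - L * \<bar>x - y\<bar> \<le> h x" for x y
    unfolding h_def by (rule cSUP_upper[OF _ bdd]) simp
  have "h x \<le> h z + L * \<bar>x - z\<bar>" for x z
    unfolding h_def[of x]
  proof (rule cSUP_least)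
    fix y
    have "L * \<bar>z - y\<bar> \<le> L * (\<bar>x - y\<bar> + \<bar>x - z\<bar>)"
      using L by (intro mult_left_mono) auto
    then show "H y - L * \<bar>x - y\<bar> \<le> h z + L * \<bar>x - z\<bar>"
      using up[of y z] by (simp add: distrib_left)
  qed simp
  from this have "\<bar>h x - h z\<bar> \<le> L * \<bar>x - z\<bar>" for x z
    by (smt (verit) abs_minus_commute)
  moreover have "H x \<le> h x" for x
    using up[of x x] by simp
  moreover have "h x \<le> H x + L" for x
    unfolding h_def
  proof (rule cSUP_least)
    show "H y - L * \<bar>x - y\<bar> \<le> H x + L" for y
      using HL[of y x] by (simp add: distrib_left abs_minus_commute)
  qed simp
  ultimately show thesis using that by blast
qed

lemma (in prob_space) interval_prob_bound:
  fixes Y :: "'a \<Rightarrow> real"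
  assumes [measurable]: "Y \<in> borel_measurable M"
    and q: "\<And>t. prob {\<omega> \<in> space M. t \<le> Y \<omega> \<and> Y \<omega> \<le> t + 1} \<le> q" and d: "0 \<le> d"
  shows "prob {\<omega> \<in> space M. t \<le> Y \<omega> \<and> Y \<omega> \<le> t + d} \<le> (d + 1) * q"
proof -
  have n: "prob {\<omega> \<in> space M. t \<le> Y \<omega> \<and> Y \<omega> \<le> t + (real n + 1)} \<le> (real n + 1) * q" for n t
  proof (induction n arbitrary: t)
    case (Suc n)
    have "prob {\<omega> \<in> space M. t \<le> Y \<omega> \<and> Y \<omega> \<le> t + (real (Suc n) + 1)}
        \<le> prob ({\<omega> \<in> space M. t \<le> Y \<omega> \<and> Y \<omega> \<le> t + 1} \<union>
            {\<omega> \<in> space M. t + 1 \<le> Y \<omega> \<and> Y \<omega> \<le> (t + 1) + (real n + 1)})"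
      by (intro finite_measure_mono) auto
    also have "\<dots> \<le> prob {\<omega> \<in> space M. t \<le> Y \<omega> \<and> Y \<omega> \<le> t + 1} +
        prob {\<omega> \<in> space M. t + 1 \<le> Y \<omega> \<and> Y \<omega> \<le> (t + 1) + (real n + 1)}"
      by (intro measure_Un_le) auto
    also have "\<dots> \<le> q + (real n + 1) * q"
      by (intro add_mono q Suc.IH)
    finally show ?case by (simp add: algebra_simps)
  qed (use q in simp)
  have "0 \<le> q" using q[of 0] measure_nonneg order_trans by blast
  \<comment> \<open>The interval is covered by \<open>k + 1\<close> unit intervals, and rounding
    down keeps this number at most \<open>d + 1\<close>.\<close>
  define k where "k = nat \<lfloor>d\<rfloor>"
  have k: "real k \<le> d" "d \<le> real k + 1" using d by (auto simp: k_def)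
  have "prob {\<omega> \<in> space M. t \<le> Y \<omega> \<and> Y \<omega> \<le> t + d} \<le> prob {\<omega> \<in> space M. t \<le> Y \<omega> \<and> Y \<omega> \<le> t + (real k + 1)}"
    using k by (intro finite_measure_mono) auto
  also have "\<dots> \<le> (real k + 1) * q" by (rule n)
  also have "\<dots> \<le> (d + 1) * q" using k \<open>0 \<le> q\<close> by (intro mult_right_mono) auto
  finally show ?thesis .
qed


section \<open>Replacement of blocks\<close>

text \<open>The shift \<open>v\<close> carries the contribution of a block held fixed, and letting
  \<open>D\<close> depend on the coordinate admits hybrid rows between the two laws.\<close>

definition box_prob :: "('i \<Rightarrow> real measure) \<Rightarrow> 'i set \<Rightarrow> nat \<Rightarrow> (nat \<Rightarrow> 'i \<Rightarrow> real) \<Rightarrow> real \<Rightarrow> (nat \<Rightarrow> real) \<Rightarrow> real" where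
  "box_prob D J m a K v =
     measure (PiM J D) {x \<in> space (PiM J D). \<forall>i<m. \<bar>(\<Sum>k\<in>J. a i k * x k) + v i\<bar> \<le> K}"

lemma measurable_weighted_sum:
  fixes D :: "'i \<Rightarrow> real measure"
  assumes "\<And>i. sets (D i) = sets borel"
  shows "(\<lambda>x. \<Sum>k\<in>J. c k * x k) \<in> borel_measurable (PiM J D)"
proof -
  have "k \<in> J \<Longrightarrow> (\<lambda>x. x k) \<in> borel_measurable (PiM J D)" for k
    using measurable_component_singleton[of k J D] assms[of k] measurable_cong_sets by blast
  then show ?thesis by (intro borel_measurable_sum borel_measurable_times) auto
qed

text \<open>Moving the shift by \<open>\<bar>s - s'\<bar>\<close> can violate a constraint only if
  its sum was that close to one of the two edges. Summing the concentration bound over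
  \<open>2 * m\<close> edges gives the estimate. The \<open>+ 1\<close> accounts for possible atoms,
  which can carry mass of order \<open>q\<close> at an edge.\<close>

lemma box_prob_near_lipschitz:
  assumes fin: "finite J" and J: "J \<noteq> {}" and D: "\<And>i. normalized_law \<rho> (D i)" and rho: "\<rho> > 0"
    and a: "\<And>i k. i < m \<Longrightarrow> k \<in> J \<Longrightarrow> a i k \<in> {-1, 1}"
    and p: "\<And>i. i < m \<Longrightarrow> p i \<in> {-1, 1 :: real}"
  defines "q \<equiv> (2 + 8 * \<rho> + 64 * \<rho>\<^sup>2) / sqrt (real (card J))"
  shows "box_prob D J m a K (\<lambda>i. p i * s) \<le> box_prob D J m a K (\<lambda>i. p i * s') + 2 * real m * q * (\<bar>s - s'\<bar> + 1)"
proof -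
  note pD = prob_space_normalized_law[OF D] and sD = sets_normalized_law[OF D]
  interpret prob_space "PiM J D" by (intro prob_space_PiM pD)
  let ?M = "PiM J D"
  define Y where "Y i x = (\<Sum>k\<in>J. a i k * x k)" for i x
  have Ym[measurable]: "Y i \<in> borel_measurable ?M" for i
    unfolding Y_def[abs_def] by (rule measurable_weighted_sum[OF sD])
  have conc: "prob {x \<in> space ?M. t \<le> Y i x \<and> Y i x \<le> t + 1} \<le> q" if i: "i < m" for i t
  proof -
    interpret U: unit_variance_family ?M "\<lambda>k x. a i k * x k" J \<rho>
      by (rule unit_variance_family_PiM[OF fin D a[OF i]])
    have "U.S = Y i" by (rule ext) (simp add: U.S_def Y_def)
    then show ?thesis using U.concentration[OF J rho, of t] by (simp add: q_def)
  qed
  define d where "d = \<bar>s - s'\<bar>"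
  have d: "d \<ge> 0" by (simp add: d_def)
  define E where "E s = {x \<in> space ?M. \<forall>i<m. \<bar>Y i x + p i * s\<bar> \<le> K}" for s
  \<comment> \<open>Two windows of width \<open>d\<close>, just inside the upper and the lower edge
    of the constraint as seen with shift \<open>s\<close>.\<close>
  define F where "F i = {x \<in> space ?M. K - d - p i * s \<le> Y i x \<and> Y i x \<le> (K - d - p i * s) + d} \<union>
    {x \<in> space ?M. - K - p i * s \<le> Y i x \<and> Y i x \<le> (- K - p i * s) + d}" for i
  have Em[measurable]: "E s \<in> events" for s unfolding E_def by measurable
  have Fm[measurable]: "F i \<in> events" for i unfolding F_def by measurable
  have F: "prob (F i) \<le> 2 * (d + 1) * q" if i: "i < m" for i
  proof -
    have "prob (F i) \<le> (d + 1) * q + (d + 1) * q"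
      unfolding F_def
      by (intro order_trans[OF measure_Un_le add_mono] interval_prob_bound conc i d) measurable
    then show ?thesis by (simp add: algebra_simps)
  qed
  have "E s \<subseteq> E s' \<union> (\<Union>i<m. F i)"
  proof
    fix x assume x: "x \<in> E s"
    show "x \<in> E s' \<union> (\<Union>i<m. F i)"
    proof (cases "x \<in> E s'")
      case False
      then obtain i where i: "i < m" "\<not> \<bar>Y i x + p i * s'\<bar> \<le> K" using x by (auto simp: E_def)
      have "\<bar>p i * s - p i * s'\<bar> = d"
        using p[OF i(1)] by (auto simp: d_def)
      moreover have "\<bar>Y i x + p i * s\<bar> \<le> K" "x \<in> space ?M" using x i(1) by (auto simp: E_def)
      ultimately have "x \<in> F i" using i(2) unfolding F_def by (auto simp: abs_le_iff abs_if split: if_splits)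
      then show ?thesis using i(1) by auto
    qed simp
  qed
  then have "prob (E s) \<le> prob (E s' \<union> (\<Union>i<m. F i))"
    by (intro finite_measure_mono) auto
  also have "\<dots> \<le> prob (E s') + prob (\<Union>i<m. F i)"
    by (intro measure_Un_le) auto
  also have "prob (\<Union>i<m. F i) \<le> (\<Sum>i<m. prob (F i))"
    by (intro measure_UNION_le) auto
  also have "\<dots> \<le> (\<Sum>i<m. 2 * (d + 1) * q)"
    by (intro sum_mono F) auto
  also have "\<dots> = 2 * real m * q * (d + 1)"
    by simp
  finally show ?thesis
    by (simp add: box_prob_def E_def Y_def d_def)
qed

lemma measurable_box_prob:
  assumes D: "\<And>i. prob_space (D i)" and sD: "\<And>i. sets (D i) = sets borel"
  shows "(\<lambda>s. box_prob D J m a K (\<lambda>i. p i * s)) \<in> borel_measurable borel"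
proof -
  interpret prob_space "PiM J D" by (intro prob_space_PiM D)
  note [measurable] = measurable_weighted_sum[OF sD]
  define G where "G = {z \<in> space (borel \<Otimes>\<^sub>M PiM J D).
    \<forall>i<m. \<bar>(\<Sum>k\<in>J. a i k * snd z k) + p i * fst z\<bar> \<le> K}"
  have [measurable]: "(\<lambda>z. \<Sum>k\<in>J. c k * snd z k) \<in> borel_measurable (borel \<Otimes>\<^sub>M PiM J D)" for c
    by (rule measurable_compose[OF measurable_snd measurable_weighted_sum[OF sD]])
  have Gm[measurable]: "G \<in> sets (borel \<Otimes>\<^sub>M PiM J D)"
    unfolding G_def by measurable
  have "(\<lambda>s. \<integral>y. indicat_real G (s, y) \<partial>PiM J D) \<in> borel_measurable borel"
    by measurable
  moreover have "(\<integral>y. indicat_real G (s, y) \<partial>PiM J D) = box_prob D J m a K (\<lambda>i. p i * s)" for s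
  proof -
    have "(\<integral>y. indicat_real G (s, y) \<partial>PiM J D)
        = (\<integral>y. indicat_real {y \<in> space (PiM J D). \<forall>i<m. \<bar>(\<Sum>k\<in>J. a i k * y k) + p i * s\<bar> \<le> K} y \<partial>PiM J D)"
      by (intro Bochner_Integration.integral_cong) (auto simp: G_def indicator_def space_pair_measure)
    also have "\<dots> = box_prob D J m a K (\<lambda>i. p i * s)"
      unfolding box_prob_def by (subst Bochner_Integration.integral_indicator) (auto simp: Int_def intro!: arg_cong[where f="measure _"])
    finally show ?thesis .
  qed
  ultimately show ?thesis by simp
qed

lemma box_prob_fubini:
  assumes fin: "finite B" "finite J" "B \<inter> J = {}"
    and D: "\<And>i. prob_space (D i)" and sD: "\<And>i. sets (D i) = sets borel"
    and p: "\<And>i k. i < m \<Longrightarrow> k \<in> B \<Longrightarrow> a i k = p i"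
  shows "box_prob D (B \<union> J) m a K (\<lambda>_. 0)
      = (\<integral>x. box_prob D J m a K (\<lambda>i. p i * (\<Sum>k\<in>B. x k)) \<partial>PiM B D)"
proof -
  interpret P: product_prob_space D "B \<union> J" using D by (intro product_prob_spaceI)
  interpret prob_space "PiM (B \<union> J) D" by (intro prob_space_PiM D)
  define E where "E = {x \<in> space (PiM (B \<union> J) D). \<forall>i<m. \<bar>\<Sum>k\<in>B \<union> J. a i k * x k\<bar> \<le> K}"
  note [measurable] = measurable_weighted_sum[OF sD]
  have Em: "E \<in> sets (PiM (B \<union> J) D)" unfolding E_def by measurable
  have "measure (PiM (B \<union> J) D) E = (\<integral>x. indicator E x \<partial>PiM (B \<union> J) D)"
    using Em by simp
  also have "\<dots> = (\<integral>x. (\<integral>y. indicator E (merge B J (x, y)) \<partial>PiM J D) \<partial>PiM B D)"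
    using fin Em by (intro P.product_integral_fold P.P.integrable_const_bound[of _ 1]) auto
  also have "\<dots> = (\<integral>x. box_prob D J m a K (\<lambda>i. p i * (\<Sum>k\<in>B. x k)) \<partial>PiM B D)"
  proof (rule Bochner_Integration.integral_cong[OF refl])
    fix x assume x: "x \<in> space (PiM B D)"
    define G where "G = {y \<in> space (PiM J D). \<forall>i<m. \<bar>(\<Sum>k\<in>J. a i k * y k) + p i * (\<Sum>k\<in>B. x k)\<bar> \<le> K}"
    have Gm: "G \<in> sets (PiM J D)" unfolding G_def by measurable
    have "merge B J (x, y) \<in> E \<longleftrightarrow> y \<in> G" if y: "y \<in> space (PiM J D)" for y
    proof -
      have "merge B J (x, y) \<in> space (PiM (B \<union> J) D)"
        using x y measurable_space[OF measurable_merge, of "(x, y)" B D J] by (simp add: space_pair_measure)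
      moreover have "(\<Sum>k\<in>B \<union> J. a i k * merge B J (x, y) k) = (\<Sum>k\<in>J. a i k * y k) + p i * (\<Sum>k\<in>B. x k)"
        if "i < m" for i
      proof -
        have "(\<Sum>k\<in>B. a i k * merge B J (x, y) k) = p i * (\<Sum>k\<in>B. x k)"
          using p[OF that] by (simp add: sum_distrib_left merge_def)
        moreover have "(\<Sum>k\<in>J. a i k * merge B J (x, y) k) = (\<Sum>k\<in>J. a i k * y k)"
          using fin(3) by (intro sum.cong) (auto simp: merge_def)
        ultimately show ?thesis using fin by (simp add: sum.union_disjoint)
      qed
      ultimately show ?thesis using y by (auto simp: E_def G_def)
    qed
    then have "(\<integral>y. indicator E (merge B J (x, y)) \<partial>PiM J D) = (\<integral>y. indicat_real G y \<partial>PiM J D)"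
      by (intro Bochner_Integration.integral_cong) (auto simp: indicator_def)
    also have "\<dots> = box_prob D J m a K (\<lambda>i. p i * (\<Sum>k\<in>B. x k))"
      using Gm by (simp add: box_prob_def G_def)
    finally show "(\<integral>y. indicator E (merge B J (x, y)) \<partial>PiM J D) = box_prob D J m a K (\<lambda>i. p i * (\<Sum>k\<in>B. x k))" .
  qed
  finally show ?thesis by (simp add: box_prob_def E_def)
qed

lemma box_prob_nonneg: "0 \<le> box_prob D J m a K v"
  unfolding box_prob_def by (rule measure_nonneg)

lemma box_prob_le_1: "(\<And>i. prob_space (D i)) \<Longrightarrow> box_prob D J m a K v \<le> 1"
  unfolding box_prob_def by (intro prob_space.prob_le_1 prob_space_PiM)

text \<open>Both rows have the same law on \<open>J\<close>, hence the same conditional probability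
  \<open>H\<close>; only the law of the block sum changes. Going up from \<open>H\<close> to its
  envelope \<open>h\<close> is free, exchanging the laws costs \<open>46 * (\<rho> + 1)\<close>
  times the Lipschitz constant, and returning from \<open>h\<close> to \<open>H\<close> costs that
  constant once more.\<close>

lemma box_prob_replace_block:
  assumes fin: "finite B" "finite J" "B \<inter> J = {}" and J: "J \<noteq> {}" and rho: "\<rho> > 0"
    and D: "\<And>i. normalized_law \<rho> (D i)" and T: "normalized_law \<rho> T" and N: "normalized_law \<rho> N"
    and a: "\<And>i k. i < m \<Longrightarrow> k \<in> J \<Longrightarrow> a i k \<in> {-1, 1}"
    and p: "\<And>i. i < m \<Longrightarrow> p i \<in> {-1, 1 :: real}" "\<And>i k. i < m \<Longrightarrow> k \<in> B \<Longrightarrow> a i k = p i"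
    and DB: "\<And>k. k \<in> B \<Longrightarrow> D k = T"
  defines "q \<equiv> (2 + 8 * \<rho> + 64 * \<rho>\<^sup>2) / sqrt (real (card J))"
  shows "box_prob D (B \<union> J) m a K (\<lambda>_. 0)
    \<le> box_prob (\<lambda>k. if k \<in> B then N else D k) (B \<union> J) m a K (\<lambda>_. 0) + (46 * (\<rho> + 1) + 1) * (2 * (real m + 1) * q)"
proof -
  let ?D' = "\<lambda>k. if k \<in> B then N else D k"
  have D': "normalized_law \<rho> (?D' i)" for i using D N by simp
  note pD = prob_space_normalized_law[OF D] and sD = sets_normalized_law[OF D]
  note pD' = prob_space_normalized_law[OF D'] and sD' = sets_normalized_law[OF D']
  define H where "H s = box_prob D J m a K (\<lambda>i. p i * s)" for s
  have "PiM J ?D' = PiM J D" using fin by (intro PiM_cong) auto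
  then have H': "box_prob ?D' J m a K (\<lambda>i. p i * s) = H s" for s
    by (simp add: H_def box_prob_def)
  have B: "PiM B D = PiM B (\<lambda>_. T)" "PiM B ?D' = PiM B (\<lambda>_. N)"
    using DB by (auto intro!: PiM_cong)
  have q: "q > 0" using rho J fin by (simp add: q_def card_gt_0_iff add_pos_pos)
  \<comment> \<open>Using \<open>m + 1\<close> instead of \<open>m\<close> keeps \<open>L\<close>
    positive even for \<open>m = 0\<close>, so that dividing by it is legitimate.\<close>
  define L where "L = 2 * (real m + 1) * q"
  have L: "L > 0" using q by (simp add: L_def)
  have H01: "0 \<le> H s" "H s \<le> 1" for s
    using box_prob_le_1[OF pD] by (auto simp: H_def box_prob_nonneg)
  have HL: "H x \<le> H y + L * (\<bar>x - y\<bar> + 1)" for x y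
  proof -
    have "H x \<le> H y + 2 * real m * q * (\<bar>x - y\<bar> + 1)"
      unfolding H_def q_def by (rule box_prob_near_lipschitz[OF fin(2) J D rho a p(1)])
    also have "\<dots> \<le> H y + L * (\<bar>x - y\<bar> + 1)"
      using q by (intro add_left_mono mult_right_mono) (auto simp: L_def)
    finally show ?thesis .
  qed
  obtain h where h: "\<And>x y. \<bar>h x - h y\<bar> \<le> L * \<bar>x - y\<bar>" "\<And>x. H x \<le> h x" "\<And>x. h x \<le> H x + L"
    using lipschitz_envelope[of H L, OF H01 _ HL] L by auto
  have "continuous_on UNIV h"
    by (rule lipschitz_on_continuous_on[OF lipschitz_onI[of UNIV h L]]) (use h(1) L in \<open>auto simp: dist_real_def\<close>)
  then have hm[measurable]: "h \<in> borel_measurable borel" by (rule borel_measurable_continuous_onI)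
  have hb: "\<bar>h x\<bar> \<le> 1 + L" for x using h(2,3)[of x] H01[of x] by auto
  have ih: "integrable (PiM B (\<lambda>_. U)) (\<lambda>x. h (\<Sum>k\<in>B. x k))" if U: "normalized_law \<rho> U" for U
  proof -
    interpret prob_space "PiM B (\<lambda>_. U)" by (intro prob_space_PiM prob_space_normalized_law[OF U])
    have "(\<lambda>x. \<Sum>k\<in>B. 1 * x k) \<in> borel_measurable (PiM B (\<lambda>_. U))"
      by (rule measurable_weighted_sum) (rule sets_normalized_law[OF U])
    then show ?thesis
      by (intro integrable_const_bound[of _ "1 + L"]) (auto simp: hb)
  qed
  have Hm[measurable]: "H \<in> borel_measurable borel"
    unfolding H_def[abs_def] by (rule measurable_box_prob[OF pD sD])
  have iH: "integrable (PiM B (\<lambda>_. U)) (\<lambda>x. H (\<Sum>k\<in>B. x k))" if U: "normalized_law \<rho> U" for U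
  proof -
    interpret prob_space "PiM B (\<lambda>_. U)" by (intro prob_space_PiM prob_space_normalized_law[OF U])
    have "(\<lambda>x. \<Sum>k\<in>B. 1 * x k) \<in> borel_measurable (PiM B (\<lambda>_. U))"
      by (rule measurable_weighted_sum) (rule sets_normalized_law[OF U])
    then show ?thesis
      using H01 by (intro integrable_const_bound[of _ 1]) auto
  qed
  interpret N: prob_space "PiM B (\<lambda>_. N)"
    by (intro prob_space_PiM prob_space_normalized_law[OF N])
  have "box_prob D (B \<union> J) m a K (\<lambda>_. 0) = (\<integral>x. H (\<Sum>k\<in>B. x k) \<partial>PiM B (\<lambda>_. T))"
    using box_prob_fubini[where m=m and a=a and p=p and D=D, OF fin pD sD p(2)] by (simp add: H_def B(1))
  also have "\<dots> \<le> (\<integral>x. h (\<Sum>k\<in>B. x k) \<partial>PiM B (\<lambda>_. T))"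
    by (intro integral_mono iH ih T h)
  also have "\<dots> \<le> (\<integral>x. h (\<Sum>k\<in>B. x k) \<partial>PiM B (\<lambda>_. N)) + 46 * (\<rho> + 1) * L"
    using block_sum_comparison[OF fin(1) T N L h(1) rho] by linarith
  also have "(\<integral>x. h (\<Sum>k\<in>B. x k) \<partial>PiM B (\<lambda>_. N)) \<le> (\<integral>x. H (\<Sum>k\<in>B. x k) + L \<partial>PiM B (\<lambda>_. N))"
    using iH[OF N] by (intro integral_mono ih N h) auto
  also have "\<dots> = (\<integral>x. H (\<Sum>k\<in>B. x k) \<partial>PiM B (\<lambda>_. N)) + L"
    using iH[OF N] by (simp add: N.prob_space)
  also have "(\<integral>x. H (\<Sum>k\<in>B. x k) \<partial>PiM B (\<lambda>_. N)) = box_prob ?D' (B \<union> J) m a K (\<lambda>_. 0)"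
    using box_prob_fubini[where m=m and a=a and p=p and D="?D'", OF fin pD' sD' p(2)] by (simp add: H' B(2))
  finally show ?thesis by (simp add: L_def algebra_simps)
qed

text \<open>Splitting the coordinates not only by sign pattern but also by parity keeps every block
  away from at least about half of the coordinates, so the concentration bound for the remaining
  ones is of order \<open>1 / sqrt n\<close>, even when all rows of \<open>a\<close> are proportional.\<close>

lemma box_prob_comparison:
  assumes T: "normalized_law \<rho> T" and N: "normalized_law \<rho> N" and rho: "\<rho> > 0" and n: "n \<ge> 1"
    and a: "\<And>i k. i < m \<Longrightarrow> k < n \<Longrightarrow> a i k \<in> {-1, 1}"
  defines "C \<equiv> 2 ^ (m + 1) * ((46 * (\<rho> + 1) + 1) * (2 * (real m + 1) * (2 * (2 + 8 * \<rho> + 64 * \<rho>\<^sup>2))))"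
  shows "box_prob (\<lambda>_. T) {..<n} m a K (\<lambda>_. 0) \<le> box_prob (\<lambda>_. N) {..<n} m a K (\<lambda>_. 0) + C / sqrt (real n)"
proof (cases "n = 1")
  case True
  \<comment> \<open>With one coordinate nothing remains outside its block, so no concentration is
    available; but every factor of \<open>C\<close> is at least 1 and the claim is trivial.\<close>
  have "1 * (1 * (1 * 1)) \<le> C"
    unfolding C_def using rho one_le_power[of "2::real" "m + 1"]
    by (intro mult_mono) (auto simp: add_nonneg_nonneg)
  moreover have "box_prob (\<lambda>_. T) {..<n} m a K (\<lambda>_. 0) \<le> 1"
    using prob_space_normalized_law[OF T] by (intro box_prob_le_1)
  moreover have "0 \<le> box_prob (\<lambda>_. N) {..<n} m a K (\<lambda>_. 0)"
    by (rule box_prob_nonneg)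
  ultimately show ?thesis using True by simp
next
  case False
  then have n2: "n \<ge> 2" using n by simp
  define lab where "lab k = ((\<lambda>i\<in>{..<m}. a i k), even k)" for k
  define \<epsilon> where "\<epsilon> = (46 * (\<rho> + 1) + 1) * (2 * (real m + 1) * (2 * (2 + 8 * \<rho> + 64 * \<rho>\<^sup>2))) / sqrt (real n)"
  have eps: "\<epsilon> \<ge> 0" using rho by (simp add: \<epsilon>_def)
  define DF where "DF F k = (if lab k \<in> F then N else T)" for F k
  have DF: "normalized_law \<rho> (DF F k)" for F k using T N by (simp add: DF_def)
  have step: "box_prob (DF F) {..<n} m a K (\<lambda>_. 0) \<le> box_prob (DF (insert l F)) {..<n} m a K (\<lambda>_. 0) + \<epsilon>"
    if l: "l \<in> lab ` {..<n}" "l \<notin> F" for l F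
  proof -
    define B where "B = {k. k < n \<and> lab k = l}"
    define J where "J = {k. k < n \<and> lab k \<noteq> l}"
    have BJ: "finite B" "finite J" "B \<inter> J = {}" "B \<union> J = {..<n}" by (auto simp: B_def J_def)
    \<comment> \<open>Indices of the parity opposite to that of \<open>l\<close> all lie outside the
      block, and at least \<open>n div 2\<close> of them are below \<open>n\<close>. For
      \<open>n \<ge> 2\<close> this is at least \<open>n / 4\<close>, the source of the extra factor
      2 in \<open>C\<close>.\<close>
    have "(\<lambda>j. 2 * j + (if snd l then 1 else 0)) ` {..<n div 2} \<subseteq> J"
      by (auto simp: J_def lab_def)
    moreover have "card ((\<lambda>j::nat. 2 * j + (if snd l then 1 else 0)) ` {..<n div 2}) = n div 2"
      by (subst card_image) (auto simp: inj_on_def)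
    ultimately have "n div 2 \<le> card J" using card_mono[OF BJ(2)] by metis
    moreover have "n \<le> 4 * (n div 2)" using n2 by linarith
    ultimately have cJ: "real n / 4 \<le> real (card J)" by linarith
    then have Jne: "J \<noteq> {}" using n by auto
    obtain k0 where k0: "k0 < n" "lab k0 = l" using l by auto
    have p: "a i k = a i k0" if "i < m" "k \<in> B" for i k
    proof -
      have "fst (lab k) i = fst (lab k0) i" using that k0 by (simp add: B_def)
      then show ?thesis using that(1) by (simp add: lab_def)
    qed
    define q where "q = (2 + 8 * \<rho> + 64 * \<rho>\<^sup>2) / sqrt (real (card J))"
    have "box_prob (DF F) (B \<union> J) m a K (\<lambda>_. 0)
      \<le> box_prob (\<lambda>k. if k \<in> B then N else DF F k) (B \<union> J) m a K (\<lambda>_. 0) + (46 * (\<rho> + 1) + 1) * (2 * (real m + 1) * q)"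
      unfolding q_def
      by (rule box_prob_replace_block[where p="\<lambda>i. a i k0", OF BJ(1-3) Jne rho DF T N _ _ p])
         (use a k0 l in \<open>auto simp: J_def B_def DF_def\<close>)
    moreover have "box_prob (\<lambda>k. if k \<in> B then N else DF F k) (B \<union> J) m a K (\<lambda>_. 0)
        = box_prob (DF (insert l F)) (B \<union> J) m a K (\<lambda>_. 0)"
    proof -
      have "PiM (B \<union> J) (\<lambda>k. if k \<in> B then N else DF F k) = PiM (B \<union> J) (DF (insert l F))"
        by (intro PiM_cong) (auto simp: DF_def B_def J_def)
      then show ?thesis by (simp add: box_prob_def)
    qed
    moreover have "(46 * (\<rho> + 1) + 1) * (2 * (real m + 1) * q) \<le> \<epsilon>"
    proof -
      have "sqrt (real n) / 2 \<le> sqrt (real (card J))"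
        using real_sqrt_le_mono[OF cJ] by (simp add: real_sqrt_divide)
      then have "q \<le> (2 + 8 * \<rho> + 64 * \<rho>\<^sup>2) / (sqrt (real n) / 2)"
        unfolding q_def using rho n by (intro divide_left_mono) (auto intro!: mult_pos_pos simp: card_gt_0_iff BJ Jne)
      then have "(46 * (\<rho> + 1) + 1) * (2 * (real m + 1) * q)
          \<le> (46 * (\<rho> + 1) + 1) * (2 * (real m + 1) * ((2 + 8 * \<rho> + 64 * \<rho>\<^sup>2) / (sqrt (real n) / 2)))"
        using rho by (intro mult_left_mono) auto
      then show ?thesis by (simp add: \<epsilon>_def mult_ac)
    qed
    ultimately show ?thesis unfolding BJ(4) by linarith
  qed
  \<comment> \<open>A hybrid argument over the labels already made Gaussian: each new label costs
    \<open>\<epsilon>\<close>, and at most \<open>2 ^ (m + 1)\<close> labels occur, whatever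
    \<open>n\<close> is.\<close>
  have ind: "box_prob (DF {}) {..<n} m a K (\<lambda>_. 0) \<le> box_prob (DF F) {..<n} m a K (\<lambda>_. 0) + real (card F) * \<epsilon>"
    if "finite F" "F \<subseteq> lab ` {..<n}" for F
    using that
  proof (induction F rule: finite_induct)
    case (insert l F)
    then show ?case using step[of l F] by (simp add: algebra_simps)
  qed simp
  have sub: "lab ` {..<n} \<subseteq> ({..<m} \<rightarrow>\<^sub>E {-1, 1}) \<times> UNIV"
  proof (rule image_subsetI)
    fix k assume "k \<in> {..<n}"
    then have "(\<lambda>i\<in>{..<m}. a i k) \<in> {..<m} \<rightarrow>\<^sub>E {-1, 1}"
      using a by (intro restrict_PiE_iff[THEN iffD2]) blast
    then show "lab k \<in> ({..<m} \<rightarrow>\<^sub>E {-1, 1}) \<times> UNIV"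
      by (simp add: lab_def)
  qed
  have "card (lab ` {..<n}) \<le> card (({..<m} \<rightarrow>\<^sub>E {-1, 1 :: real}) \<times> (UNIV :: bool set))"
    by (rule card_mono[OF _ sub]) (auto intro!: finite_PiE)
  also have "\<dots> = 2 ^ (m + 1)"
    by (simp add: card_cartesian_product card_PiE numeral_2_eq_2)
  finally have "real (card (lab ` {..<n})) \<le> 2 ^ (m + 1)"
    by (metis of_nat_le_iff of_nat_numeral of_nat_power)
  then have "real (card (lab ` {..<n})) * \<epsilon> \<le> 2 ^ (m + 1) * \<epsilon>"
    using eps by (rule mult_right_mono)
  moreover have "box_prob (DF (lab ` {..<n})) {..<n} m a K (\<lambda>_. 0) = box_prob (\<lambda>_. N) {..<n} m a K (\<lambda>_. 0)"
  proof -
    have "PiM {..<n} (DF (lab ` {..<n})) = PiM {..<n} (\<lambda>_. N)"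
      by (intro PiM_cong) (auto simp: DF_def)
    then show ?thesis by (simp add: box_prob_def)
  qed
  moreover have "DF {} = (\<lambda>_. T)" by (simp add: DF_def fun_eq_iff)
  moreover have "2 ^ (m + 1) * \<epsilon> = C / sqrt (real n)" by (simp add: C_def \<epsilon>_def)
  ultimately show ?thesis using ind[of "lab ` {..<n}"] by simp
qed


section \<open>The Gaussian row probability\<close>

lemma std_normal_interval_pos:
  assumes "\<delta> > 0"
  shows "measure std_normal_distribution {-\<delta>..\<delta>} > 0"
proof -
  interpret real_distribution std_normal_distribution by (rule real_dist_normal_dist)
  have nz: "std_normal_density x \<noteq> 0" for x
    using normal_density_pos[of 1 0 x] by simp
  have "{-\<delta>..\<delta>} \<notin> null_sets std_normal_distribution"
  proof
    assume "{-\<delta>..\<delta>} \<in> null_sets std_normal_distribution"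
    then have "AE x in lborel. x \<notin> {-\<delta>..\<delta>}"
      by (subst (asm) null_sets_density_iff) (auto elim!: eventually_mono simp: nz)
    then have "emeasure lborel {-\<delta>..\<delta>} = 0"
      by (subst (asm) AE_iff_measurable[where N="{-\<delta>..\<delta>}"]) auto
    then show False using assms by simp
  qed
  then have "emeasure std_normal_distribution {-\<delta>..\<delta>} \<noteq> 0" by auto
  then show ?thesis by (simp add: emeasure_eq_measure zero_less_measure_iff)
qed

lemma (in prob_space) std_normal_sum_interval_prob:
  fixes X :: "'i \<Rightarrow> 'a \<Rightarrow> real"
  assumes fin: "finite I" and ne: "I \<noteq> {}" and ind: "indep_vars (\<lambda>_. borel) X I"
    and X: "\<And>i. i \<in> I \<Longrightarrow> distributed M lborel (X i) std_normal_density"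
  shows "prob {\<omega> \<in> space M. \<bar>\<Sum>i\<in>I. X i \<omega>\<bar> \<le> \<delta> * sqrt (real (card I))} = measure std_normal_distribution {-\<delta>..\<delta>}"
proof -
  define s where "s = sqrt (real (card I))"
  have s: "s > 0" using fin ne by (simp add: s_def card_gt_0_iff)
  have "distributed M lborel (\<lambda>\<omega>. \<Sum>i\<in>I. X i \<omega>) (normal_density (\<Sum>i\<in>I. 0) (sqrt (\<Sum>i\<in>I. 1\<^sup>2)))"
    by (rule sum_indep_normal[OF fin ne ind]) (auto intro: X)
  then have "distributed M lborel (\<lambda>\<omega>. ((\<Sum>i\<in>I. X i \<omega>) - 0) / s) std_normal_density"
    using s by (subst normal_standard_normal_convert[symmetric]) (auto simp: s_def)
  then have d: "distr M lborel (\<lambda>\<omega>. (\<Sum>i\<in>I. X i \<omega>) / s) = std_normal_distribution"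
    and m: "(\<lambda>\<omega>. (\<Sum>i\<in>I. X i \<omega>) / s) \<in> measurable M lborel"
    by (auto simp: distributed_def)
  have "measure std_normal_distribution {-\<delta>..\<delta>} = prob ((\<lambda>\<omega>. (\<Sum>i\<in>I. X i \<omega>) / s) -` {-\<delta>..\<delta>} \<inter> space M)"
    unfolding d[symmetric] using m by (rule measure_distr) simp
  also have "(\<lambda>\<omega>. (\<Sum>i\<in>I. X i \<omega>) / s) -` {-\<delta>..\<delta>} \<inter> space M = {\<omega> \<in> space M. \<bar>\<Sum>i\<in>I. X i \<omega>\<bar> \<le> \<delta> * s}"
    using s by (auto simp: abs_le_iff field_simps)
  finally show ?thesis by (simp add: s_def)
qed

text \<open>Group the coordinates by sign pattern. The at most \<open>2 ^ m\<close> block sums are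
  independent Gaussians of variance at most \<open>n\<close>, and each constraint is a signed sum of
  them. It suffices that every block sum is at most \<open>\<kappa> * sqrt n / 2 ^ m\<close> in
  absolute value, so linear dependence between the constraints does no harm.\<close>

lemma normal_box_prob_lower_bound:
  assumes \<kappa>: "\<kappa> > 0" and a: "\<And>i k. i < m \<Longrightarrow> k < n \<Longrightarrow> a i k \<in> {-1, 1 :: real}"
  shows "measure std_normal_distribution {- (\<kappa> / 2 ^ m)..\<kappa> / 2 ^ m} ^ (2 ^ m)
    \<le> box_prob (\<lambda>_. std_normal_distribution) {..<n} m a (\<kappa> * sqrt (real n)) (\<lambda>_. 0)"
proof -
  define \<delta> where "\<delta> = \<kappa> / 2 ^ m"
  have \<delta>: "\<delta> > 0" using \<kappa> by (simp add: \<delta>_def)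
  define g where "g = measure std_normal_distribution {-\<delta>..\<delta>}"
  interpret D: real_distribution std_normal_distribution by (rule real_dist_normal_dist)
  let ?M = "PiM {..<n} (\<lambda>_. std_normal_distribution)"
  interpret prob_space ?M by (intro prob_space_PiM D.prob_space_axioms)
  have indep: "indep_vars (\<lambda>_. borel) (\<lambda>k x. x k) {..<n}"
    by (rule indep_vars_PiM_coordinates) (auto intro: D.prob_space_axioms)
  have dist: "distributed ?M lborel (\<lambda>x. x k) std_normal_density" if "k < n" for k
  proof -
    have "distr ?M lborel (\<lambda>x. x k) = distr ?M std_normal_distribution (\<lambda>x. x k)"
      by (rule distr_cong) simp_all
    also have "\<dots> = std_normal_distribution"
      using that by (intro distr_PiM_component D.prob_space_axioms) auto
    moreover have "(\<lambda>x. x k) \<in> measurable ?M std_normal_distribution"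
      using that by (intro measurable_component_singleton) auto
    ultimately show ?thesis by (auto simp: distributed_def)
  qed
  define lab where "lab k = (\<lambda>i\<in>{..<m}. a i k)" for k
  define \<Lambda> where "\<Lambda> = lab ` {..<n}"
  define B where "B l = {k. k < n \<and> lab k = l}" for l
  have "\<Lambda> \<subseteq> {..<m} \<rightarrow>\<^sub>E {-1, 1}"
    unfolding \<Lambda>_def
  proof (rule image_subsetI)
    fix k assume "k \<in> {..<n}"
    then show "lab k \<in> {..<m} \<rightarrow>\<^sub>E {-1, 1}"
      unfolding lab_def using a by (intro restrict_PiE_iff[THEN iffD2]) blast
  qed
  then have "card \<Lambda> \<le> card ({..<m} \<rightarrow>\<^sub>E {-1, 1 :: real})"
    by (intro card_mono finite_PiE) auto
  also have "\<dots> = 2 ^ m" by (simp add: card_PiE numeral_2_eq_2)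
  finally have card: "card \<Lambda> \<le> 2 ^ m" .
  then have cardr: "real (card \<Lambda>) \<le> 2 ^ m"
    by (metis of_nat_le_iff of_nat_numeral of_nat_power)
  have fin: "finite \<Lambda>" by (simp add: \<Lambda>_def)
  define G where "G l x = (\<Sum>k\<in>B l. x k)" for l and x :: "nat \<Rightarrow> real"
  have indG: "indep_vars (\<lambda>_. borel) G \<Lambda>"
  proof -
    have "indep_vars (\<lambda>l. PiM (B l) (\<lambda>_. borel)) (\<lambda>l x. restrict (\<lambda>k. x k) (B l)) \<Lambda>"
      by (rule indep_vars_restrict[OF indep]) (auto simp: B_def disjoint_family_on_def)
    then have "indep_vars (\<lambda>_. borel) (\<lambda>l x. (\<lambda>y. \<Sum>k\<in>B l. y k) (restrict (\<lambda>k. x k) (B l))) \<Lambda>"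
      by (rule indep_vars_compose2) measurable
    then show ?thesis by (simp add: G_def[abs_def])
  qed
  define E where "E l = {x \<in> space ?M. \<bar>G l x\<bar> \<le> \<delta> * sqrt (real n)}" for l
  have Gm: "G l \<in> borel_measurable ?M" if "l \<in> \<Lambda>" for l
    using indG that by (auto simp: indep_vars_def)
  have gE: "g \<le> prob (E l)" if l: "l \<in> \<Lambda>" for l
  proof -
    have B: "finite (B l)" "B l \<noteq> {}" "B l \<subseteq> {..<n}" using l by (auto simp: B_def \<Lambda>_def)
    have "g = prob {x \<in> space ?M. \<bar>G l x\<bar> \<le> \<delta> * sqrt (real (card (B l)))}"
      unfolding g_def G_def using B dist
      by (intro std_normal_sum_interval_prob[symmetric] indep_vars_subset[OF indep]) auto
    also have "\<dots> \<le> prob (E l)"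
    proof (rule finite_measure_mono)
      show "E l \<in> events" unfolding E_def using Gm[OF l] by measurable
      have "card (B l) \<le> n" using card_mono[OF _ B(3)] by simp
      then have "\<delta> * sqrt (real (card (B l))) \<le> \<delta> * sqrt (real n)" using \<delta> by simp
      then show "{x \<in> space ?M. \<bar>G l x\<bar> \<le> \<delta> * sqrt (real (card (B l)))} \<subseteq> E l"
        by (auto simp: E_def)
    qed
    finally show ?thesis .
  qed
  have g01: "0 \<le> g" "g \<le> 1" by (simp_all add: g_def D.prob_le_1)
  let ?F = "{x \<in> space ?M. \<forall>i<m. \<bar>(\<Sum>k<n. a i k * x k) + 0\<bar> \<le> \<kappa> * sqrt (real n)}"
  \<comment> \<open>Since \<open>g \<le> 1\<close>, raising the exponent from the number of patterns
    that occur to the number of all patterns makes the bound independent of the tuple and of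
    \<open>n\<close>.\<close>
  have "g ^ (2 ^ m) \<le> g ^ card \<Lambda>"
    using card g01 by (rule power_decreasing)
  also have "\<dots> \<le> (\<Prod>l\<in>\<Lambda>. prob (E l))"
    using prod_mono[of \<Lambda> "\<lambda>_. g" "\<lambda>l. prob (E l)"] gE g01 by simp
  also have "\<dots> \<le> prob ?F"
  proof (cases "\<Lambda> = {}")
    case True
    then have "n = 0" by (simp add: \<Lambda>_def lessThan_empty_iff)
    then have "?F = space ?M" by simp
    then have "prob ?F = 1" by (simp only: prob_space)
    then show ?thesis using True by simp
  next
    case False
    have "(\<Prod>l\<in>\<Lambda>. prob (E l)) = (\<Prod>l\<in>\<Lambda>. prob (G l -` {- (\<delta> * sqrt (real n))..\<delta> * sqrt (real n)} \<inter> space ?M))"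
      by (intro prod.cong refl arg_cong[where f=prob]) (auto simp: E_def abs_le_iff)
    also have "\<dots> = prob (\<Inter>l\<in>\<Lambda>. G l -` {- (\<delta> * sqrt (real n))..\<delta> * sqrt (real n)} \<inter> space ?M)"
      using False fin by (intro indep_varsD_finite[symmetric, OF indG]) auto
    also have "\<dots> \<le> prob ?F"
    proof (rule finite_measure_mono)
      show "?F \<in> events"
        using measurable_weighted_sum[of "\<lambda>_. std_normal_distribution" _ "{..<n}"] by measurable
      show "(\<Inter>l\<in>\<Lambda>. G l -` {- (\<delta> * sqrt (real n))..\<delta> * sqrt (real n)} \<inter> space ?M) \<subseteq> ?F"
      proof
        fix x assume x: "x \<in> (\<Inter>l\<in>\<Lambda>. G l -` {- (\<delta> * sqrt (real n))..\<delta> * sqrt (real n)} \<inter> space ?M)"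
        have Gx: "\<bar>G l x\<bar> \<le> \<delta> * sqrt (real n)" if "l \<in> \<Lambda>" for l
        proof -
          have "x \<in> G l -` {- (\<delta> * sqrt (real n))..\<delta> * sqrt (real n)}" using x that by blast
          then show ?thesis by (simp add: abs_le_iff)
        qed
        have "\<bar>\<Sum>k<n. a i k * x k\<bar> \<le> \<kappa> * sqrt (real n)" if i: "i < m" for i
        proof -
          \<comment> \<open>Regrouped by pattern, the coefficient of a whole block is the entry
            \<open>l i\<close> of the pattern itself.\<close>
          have "(\<Sum>k<n. a i k * x k) = (\<Sum>l\<in>\<Lambda>. \<Sum>k\<in>{k \<in> {..<n}. lab k = l}. a i k * x k)"
            unfolding \<Lambda>_def by (rule sum.image_gen) simp
          also have "\<dots> = (\<Sum>l\<in>\<Lambda>. l i * G l x)"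
            unfolding G_def sum_distrib_left
            by (intro sum.cong) (auto simp: B_def lab_def i)
          also have "\<bar>\<dots>\<bar> \<le> (\<Sum>l\<in>\<Lambda>. \<delta> * sqrt (real n))"
          proof (rule order_trans[OF sum_abs sum_mono])
            fix l assume l: "l \<in> \<Lambda>"
            then obtain k where k: "k < n" "l = lab k" by (auto simp: \<Lambda>_def)
            have "\<bar>l i\<bar> = 1" using a[OF i k(1)] k(2) i by (auto simp: lab_def)
            then show "\<bar>l i * G l x\<bar> \<le> \<delta> * sqrt (real n)" using Gx[OF l] by (simp add: abs_mult)
          qed
          also have "\<dots> = real (card \<Lambda>) * (\<delta> * sqrt (real n))" by simp
          also have "\<dots> \<le> 2 ^ m * (\<delta> * sqrt (real n))"
            using cardr \<delta> by (intro mult_right_mono) auto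
          also have "\<dots> = \<kappa> * sqrt (real n)" by (simp add: \<delta>_def)
          finally show ?thesis .
        qed
        moreover have "x \<in> space ?M" using x False by blast
        ultimately show "x \<in> ?F" by simp
      qed
    qed
    finally show ?thesis .
  qed
  finally show ?thesis by (simp add: box_prob_def g_def \<delta>_def)
qed


section \<open>From rows to matrices\<close>

text \<open>Rows are functions of disjoint sets of entries, hence independent, and reindexing along
  \<open>\<lambda>k. (r, k)\<close> identifies the law of each with the product law on
  \<open>n\<close> coordinates.\<close>

lemma iid_matrix_rows_prob:
  assumes D: "prob_space D" and sD: "sets D = sets borel"
    and F: "F \<in> sets (PiM {..<n} (\<lambda>_. D))"
  shows "measure (iid_matrix D M n) {A \<in> space (iid_matrix D M n). \<forall>r<M. (\<lambda>k\<in>{..<n}. A (r, k)) \<in> F}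
    = measure (PiM {..<n} (\<lambda>_. D)) F ^ M"
proof -
  let ?Q = "PiM ({..<M} \<times> {..<n}) (\<lambda>_. D)"
  interpret prob_space ?Q by (intro prob_space_PiM D)
  show ?thesis
  proof (cases "M = 0")
    case True
    then show ?thesis using prob_space by (simp add: iid_matrix_def)
  next
    case False
    define R where "R r A = (\<lambda>k\<in>{..<n}. A (r, k))" for r and A :: "nat \<times> nat \<Rightarrow> real"
    have "indep_vars (\<lambda>_. borel) (\<lambda>i x. x i) ({..<M} \<times> {..<n})"
      using D sD by (intro indep_vars_PiM_coordinates) auto
    then have "indep_vars (\<lambda>r. PiM ({r} \<times> {..<n}) (\<lambda>_. borel)) (\<lambda>r x. restrict (\<lambda>i. x i) ({r} \<times> {..<n})) {..<M}"
      by (rule indep_vars_restrict) (auto simp: disjoint_family_on_def)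
    then have "indep_vars (\<lambda>_. PiM {..<n} (\<lambda>_. borel)) (\<lambda>r x. R r (restrict (\<lambda>i. x i) ({r} \<times> {..<n}))) {..<M}"
      unfolding R_def by (rule indep_vars_compose2) (rule measurable_restrict, rule measurable_component_singleton, auto)
    moreover have "R r (restrict (\<lambda>i. x i) ({r} \<times> {..<n})) = R r x" for r and x :: "nat \<times> nat \<Rightarrow> real"
      by (auto simp: R_def fun_eq_iff)
    ultimately have ind: "indep_vars (\<lambda>_. PiM {..<n} (\<lambda>_. borel)) R {..<M}"
      by simp
    have sets: "sets (PiM {..<n} (\<lambda>_. D)) = sets (PiM {..<n} (\<lambda>_. borel))"
      using sD by (intro sets_PiM_cong) auto
    have row: "prob (R r -` F \<inter> space ?Q) = measure (PiM {..<n} (\<lambda>_. D)) F" if r: "r < M" for r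
    proof -
      have dist: "distr ?Q (PiM {..<n} (\<lambda>_. D)) (R r) = PiM {..<n} (\<lambda>_. D)"
        unfolding R_def
        using distr_PiM_reindex[of "{..<M} \<times> {..<n}" "\<lambda>_. D" "\<lambda>k. (r, k)" "{..<n}"] D r
        by (auto simp: inj_on_def)
      have "R r \<in> measurable ?Q (PiM {..<n} (\<lambda>_. D))"
        unfolding R_def using r by (intro measurable_restrict measurable_component_singleton) auto
      from measure_distr[OF this F] show ?thesis by (simp add: dist)
    qed
    have "measure ?Q {A \<in> space ?Q. \<forall>r<M. R r A \<in> F} = prob (\<Inter>r\<in>{..<M}. R r -` F \<inter> space ?Q)"
      using False by (intro arg_cong[where f=prob]) auto
    also have "\<dots> = (\<Prod>r<M. prob (R r -` F \<inter> space ?Q))"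
      using False F sets by (intro indep_varsD_finite[OF ind]) auto
    also have "\<dots> = measure (PiM {..<n} (\<lambda>_. D)) F ^ M"
      using row by simp
    finally show ?thesis by (simp add: iid_matrix_def R_def)
  qed
qed

section \<open>The first moment as a finite sum over tuples\<close>

text \<open>The deterministic part of \<open>sol_tuples\<close>. Because it does not involve the
  matrix, the expected cardinality becomes a sum over a fixed index set, the same for both
  laws.\<close>

definition overlap_tuples :: "real \<Rightarrow> real \<Rightarrow> nat \<Rightarrow> nat \<Rightarrow> (nat \<Rightarrow> nat \<Rightarrow> real) set" where
  "overlap_tuples \<beta> \<eta> m n = {\<sigma> \<in> {..<m} \<rightarrow>\<^sub>E sign_cube n. \<forall>i<m. \<forall>j<m. i < j \<longrightarrow>
     \<beta> - \<eta> \<le> inner_n n (\<sigma> i) (\<sigma> j) / real n \<and> inner_n n (\<sigma> i) (\<sigma> j) / real n \<le> \<beta>}"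

lemma finite_overlap_tuples: "finite (overlap_tuples \<beta> \<eta> m n)"
proof -
  have "finite ({..<m} \<rightarrow>\<^sub>E sign_cube n)"
    unfolding sign_cube_def by (intro finite_PiE) auto
  then show ?thesis by (simp add: overlap_tuples_def)
qed

lemma overlap_tuples_sign:
  "\<sigma> \<in> overlap_tuples \<beta> \<eta> m n \<Longrightarrow> i < m \<Longrightarrow> k < n \<Longrightarrow> \<sigma> i k \<in> {-1, 1}"
  unfolding overlap_tuples_def sign_cube_def by (auto simp: PiE_iff)

text \<open>Nonnegativity of \<open>K\<close> disposes of the \<open>0\<close> inserted into the
  maximum.\<close>

lemma sup_norm_le_iff: "0 \<le> K \<Longrightarrow> sup_norm M y \<le> K \<longleftrightarrow> (\<forall>r<M. \<bar>y r\<bar> \<le> K)"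
  unfolding sup_norm_def by (subst Max_le_iff) auto

lemma expected_sol_tuples_eq:
  assumes D: "prob_space D" and sD: "sets D = sets borel" and \<kappa>: "\<kappa> > 0"
  shows "expected_sol_tuples D \<kappa> \<beta> \<eta> m \<alpha> n =
    (\<Sum>\<sigma>\<in>overlap_tuples \<beta> \<eta> m n. box_prob (\<lambda>_. D) {..<n} m \<sigma> (\<kappa> * sqrt (real n)) (\<lambda>_. 0) ^ num_rows \<alpha> n)"
proof -
  let ?M = "num_rows \<alpha> n" and ?K = "\<kappa> * sqrt (real n)"
  let ?Q = "iid_matrix D ?M n" and ?P = "PiM {..<n} (\<lambda>_. D)"
  interpret Q: prob_space ?Q unfolding iid_matrix_def by (intro prob_space_PiM D)
  define F where "F \<sigma> = {x \<in> space ?P. \<forall>i<m. \<bar>(\<Sum>k<n. \<sigma> i k * x k) + 0\<bar> \<le> ?K}" for \<sigma>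
  have Fm: "F \<sigma> \<in> sets ?P" for \<sigma>
    unfolding F_def using measurable_weighted_sum[of "\<lambda>_. D" _ "{..<n}"] sD by measurable
  define E where "E \<sigma> = {A \<in> space ?Q. \<forall>r<?M. (\<lambda>k\<in>{..<n}. A (r, k)) \<in> F \<sigma>}" for \<sigma>
  have Em: "E \<sigma> \<in> sets ?Q" for \<sigma>
  proof -
    have "(\<lambda>A. \<lambda>k\<in>{..<n}. A (r, k)) \<in> measurable ?Q ?P" if "r < ?M" for r
      unfolding iid_matrix_def using that by (intro measurable_restrict measurable_component_singleton) auto
    then show ?thesis
      unfolding E_def using Fm by measurable
  qed
  have "card (sol_tuples \<kappa> \<beta> \<eta> m \<alpha> n A) = (\<Sum>\<sigma>\<in>overlap_tuples \<beta> \<eta> m n. indicat_real (E \<sigma>) A)"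
    if A: "A \<in> space ?Q" for A
  proof -
    have sp: "(\<lambda>k\<in>{..<n}. A (r, k)) \<in> space ?P" if "r < ?M" for r
      using A that by (auto simp: iid_matrix_def space_PiM)
    \<comment> \<open>Exchanging the quantifiers over tuple members and rows: all \<open>m\<close>
      constraints are collected into one event per row, which is what makes the rows
      factorise.\<close>
    have "(\<forall>i<m. sup_norm ?M (mat_vec n A (\<sigma> i)) \<le> ?K) \<longleftrightarrow> A \<in> E \<sigma>" for \<sigma>
      using \<kappa> A sp by (auto simp: sup_norm_le_iff E_def F_def mat_vec_def mult.commute)
    then have "sol_tuples \<kappa> \<beta> \<eta> m \<alpha> n A = {\<sigma> \<in> overlap_tuples \<beta> \<eta> m n. A \<in> E \<sigma>}"
      by (auto simp: sol_tuples_def overlap_tuples_def)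
    then show ?thesis
      using finite_overlap_tuples[of \<beta> \<eta> m n] by (simp add: indicator_def sum.If_cases Int_def)
  qed
  then have "expected_sol_tuples D \<kappa> \<beta> \<eta> m \<alpha> n
      = (\<integral>A. (\<Sum>\<sigma>\<in>overlap_tuples \<beta> \<eta> m n. indicat_real (E \<sigma>) A) \<partial>?Q)"
    unfolding expected_sol_tuples_def by (intro Bochner_Integration.integral_cong) auto
  also have "\<dots> = (\<Sum>\<sigma>\<in>overlap_tuples \<beta> \<eta> m n. measure ?Q (E \<sigma>))"
    using Em by (subst Bochner_Integration.integral_sum) (auto simp: Q.emeasure_eq_measure)
  also have "\<dots> = (\<Sum>\<sigma>\<in>overlap_tuples \<beta> \<eta> m n. box_prob (\<lambda>_. D) {..<n} m \<sigma> ?K (\<lambda>_. 0) ^ ?M)"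
    unfolding E_def iid_matrix_rows_prob[OF D sD Fm] by (simp add: box_prob_def F_def)
  finally show ?thesis .
qed

section \<open>From the additive row error to the exponential factor\<close>

lemma normalized_law_std_normal:
  "(\<integral>t. \<bar>t\<bar> ^ 3 \<partial>std_normal_distribution) \<le> \<rho> \<Longrightarrow> normalized_law \<rho> std_normal_distribution"
  using real_dist_normal_dist std_normal_distribution_even_moments(1)[of 1]
    integral_std_normal_distribution_moment_odd[of 1]
    integrable_abs[OF integrable_std_normal_distribution_moment[of 3]]
  by (simp add: normalized_law_def power_abs)

theorem theorem5p2:
  fixes D :: "real measure" and \<kappa> \<alpha> \<beta> \<eta> :: real and m :: nat
  assumes "real_distribution D"
    and "(\<integral>t. t \<partial>D) = 0"
    and "(\<integral>t. t\<^sup>2 \<partial>D) = 1"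
    and "integrable D (\<lambda>t. \<bar>t\<bar> ^ 3)"
    and "\<kappa> > 0"
    and "\<alpha> < alpha_c \<kappa>"
    and "0 < \<eta>" and "\<eta> < \<beta>" and "\<beta> < 1"
  shows "\<exists>C'::real. \<forall>n::nat. n \<ge> 1 \<longrightarrow>
           expected_sol_tuples D \<kappa> \<beta> \<eta> m \<alpha> n
             \<le> expected_sol_tuples std_normal_distribution \<kappa> \<beta> \<eta> m \<alpha> n * exp (C' * sqrt (real n))"
proof -
  let ?N = std_normal_distribution
  \<comment> \<open>The sum dominates both third moments at once, and the summand 1 makes positivity
    immediate.\<close>
  define \<rho> where "\<rho> = 1 + (\<integral>t. \<bar>t\<bar> ^ 3 \<partial>D) + (\<integral>t. \<bar>t\<bar> ^ 3 \<partial>?N)"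
  have moments: "0 \<le> (\<integral>t. \<bar>t\<bar> ^ 3 \<partial>D)" "0 \<le> (\<integral>t. \<bar>t\<bar> ^ 3 \<partial>?N)"
    by simp_all
  have "(\<integral>t. \<bar>t\<bar> ^ 3 \<partial>D) \<le> \<rho>" "(\<integral>t. \<bar>t\<bar> ^ 3 \<partial>?N) \<le> \<rho>"
    using moments unfolding \<rho>_def by linarith+
  then have D: "normalized_law \<rho> D" and N: "normalized_law \<rho> ?N"
    using assms(1-4) by (simp_all add: normalized_law_def[of _ D] normalized_law_std_normal)
  have rho: "\<rho> > 0"
    using moments unfolding \<rho>_def by linarith
  define C where "C = 2 ^ (m + 1) * ((46 * (\<rho> + 1) + 1) * (2 * (real m + 1) * (2 * (2 + 8 * \<rho> + 64 * \<rho>\<^sup>2))))"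
  define c where "c = measure ?N {- (\<kappa> / 2 ^ m)..\<kappa> / 2 ^ m} ^ (2 ^ m)"
  have c: "c > 0"
    using std_normal_interval_pos[of "\<kappa> / 2 ^ m"] \<open>\<kappa> > 0\<close> by (simp add: c_def)
  have C: "C \<ge> 0"
    using rho by (simp add: C_def)
  have "expected_sol_tuples D \<kappa> \<beta> \<eta> m \<alpha> n
      \<le> expected_sol_tuples ?N \<kappa> \<beta> \<eta> m \<alpha> n * exp (\<bar>\<alpha>\<bar> * C / c * sqrt (real n))" if n: "n \<ge> 1" for n
  proof -
    let ?p = "\<lambda>T \<sigma>. box_prob (\<lambda>_. T) {..<n} m \<sigma> (\<kappa> * sqrt (real n)) (\<lambda>_. 0)"
    let ?M = "num_rows \<alpha> n"
    \<comment> \<open>The absolute value covers negative \<open>\<alpha>\<close>, where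
      \<open>nat\<close> truncates the number of rows to 0.\<close>
    have rows: "real ?M \<le> \<bar>\<alpha>\<bar> * real n"
    proof -
      have "real ?M \<le> max 0 (real n * \<alpha>)"
        unfolding num_rows_def by (cases "0 \<le> real n * \<alpha>") (auto simp: zero_le_floor le_max_iff_disj)
      also have "\<dots> \<le> \<bar>\<alpha>\<bar> * real n"
        by (auto simp: mult.commute[of "real n"] intro!: mult_right_mono)
      finally show ?thesis .
    qed
    have "?p D \<sigma> ^ ?M \<le> ?p ?N \<sigma> ^ ?M * exp (\<bar>\<alpha>\<bar> * C / c * sqrt (real n))"
      if \<sigma>: "\<sigma> \<in> overlap_tuples \<beta> \<eta> m n" for \<sigma>
    proof -
      have "?p D \<sigma> \<le> ?p ?N \<sigma> + C / sqrt (real n)"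
        unfolding C_def using D N rho n overlap_tuples_sign[OF \<sigma>] by (rule box_prob_comparison)
      \<comment> \<open>The additive error is made relative: \<open>C = c * (C / c)\<close>, and
        \<open>c\<close> is at most the Gaussian row probability, uniformly in
        \<open>\<sigma>\<close> and \<open>n\<close>.\<close>
      also have "\<dots> \<le> ?p ?N \<sigma> + ?p ?N \<sigma> * (C / c / sqrt (real n))"
      proof -
        have "c \<le> ?p ?N \<sigma>"
          unfolding c_def using \<open>\<kappa> > 0\<close> overlap_tuples_sign[OF \<sigma>] by (rule normal_box_prob_lower_bound)
        then have "c * (C / c / sqrt (real n)) \<le> ?p ?N \<sigma> * (C / c / sqrt (real n))"
          using C c by (intro mult_right_mono) auto
        then show ?thesis using c by simp
      qed
      also have "\<dots> = ?p ?N \<sigma> * (1 + C / c / sqrt (real n))"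
        by (simp add: distrib_left)
      also have "\<dots> \<le> ?p ?N \<sigma> * exp (C / c / sqrt (real n))"
        by (intro mult_left_mono exp_ge_add_one_self box_prob_nonneg)
      finally have "?p D \<sigma> ^ ?M \<le> (?p ?N \<sigma> * exp (C / c / sqrt (real n))) ^ ?M"
        by (rule power_mono) (rule box_prob_nonneg)
      also have "\<dots> = ?p ?N \<sigma> ^ ?M * exp (real ?M * (C / c / sqrt (real n)))"
        by (simp only: power_mult_distrib exp_of_nat_mult)
      \<comment> \<open>Here the order is settled: O(n) rows, each contributing O(1 / sqrt n) to the
        exponent.\<close>
      also have "real ?M * (C / c / sqrt (real n)) \<le> \<bar>\<alpha>\<bar> * real n * (C / c / sqrt (real n))"
        using rows C c by (intro mult_right_mono) auto
      also have "\<dots> = \<bar>\<alpha>\<bar> * C / c * (real n / sqrt (real n))"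
        by (simp add: mult_ac)
      also have "\<dots> = \<bar>\<alpha>\<bar> * C / c * sqrt (real n)"
        by (simp only: real_div_sqrt of_nat_0_le_iff)
      finally show ?thesis
        by (simp add: mult_left_mono box_prob_nonneg)
    qed
    then show ?thesis
      unfolding expected_sol_tuples_eq[OF prob_space_normalized_law[OF D] sets_normalized_law[OF D] \<open>\<kappa> > 0\<close>]
        expected_sol_tuples_eq[OF prob_space_normalized_law[OF N] sets_normalized_law[OF N] \<open>\<kappa> > 0\<close>]
        sum_distrib_right
      by (rule sum_mono)
  qed
  then show ?thesis by blast
qed

end
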